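(* Let $(M,\varphi,\xi,\eta,g)$ be a regular $f$-Kenmotsu manifold with Levi-Civita connection $\nabla$. If $\alpha$ is a symmetric $(0,2)$-tensor field on $M$ with $\nabla\alpha=0$, then there is a real constant $c$ such that $\alpha=c\,g$. In other words, $g$ is irreducible: the tangent bundle does not admit a decomposition $TM=E_1\oplus E_2$ into two nonzero subbundles $E_1,E_2$ that are parallel with respect to $\nabla$.
   Context: All objects are $C^\infty$; manifolds are connected. An almost contact metric manifold is a $(2n+1)$-dimensional manifold $M$ ($n\ge 1$) with a $(1,1)$-tensor field $\varphi$, a vector field $\xi$, a 1-form $\eta$ and a Riemannian metric $g$ such that $\varphi^2=-I+\eta\otimes\xi$, $\eta(\xi)=1$, $\eta\circ\varphi=0$, $\varphi(\xi)=0$, $\eta(X)=g(X,\xi)$ and $g(\varphi X,\varphi Y)=g(X,Y)-\eta(X)\eta(Y)$ for all vector fields $X,Y$. It is an $f$-Kenmotsu manifold if its Levi-Civita connection $\nabla$ satisfies $(\nabla_X\varphi)(Y)=f\,(g(\varphi X,Y)\xi-\varphi(X)\eta(Y))$ for all $X,Y$, where $f\in C^\infty(M)$ is strictly positive and $df\wedge\eta=0$. An $f$-Kenmotsu manifold is regular if $f^2+\xi(f)\neq 0$ at every point of $M$. A subbundle $E\subset TM$ is parallel if $\nabla_X Y$ is a section of $E$ for every section $Y$ of $E$ and every vector field $X$. *)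

theory Defs
  imports "HOL-Analysis.Analysis" "HOL-Library.Function_Algebras"
begin

section \<open>Smooth maps between normed spaces\<close>

text \<open>\<open>S\<close> is meant to be open; on a finite-dimensional domain, \<open>Ck_on k\<close> is then the usual class
  of \<open>k\<close> times continuously differentiable maps.\<close>

primrec Ck_on :: "nat \<Rightarrow> ('b::real_normed_vector \<Rightarrow> 'c::real_normed_vector) \<Rightarrow> 'b set \<Rightarrow> bool" where
  "Ck_on 0 f S = continuous_on S f"
| "Ck_on (Suc k) f S =
     ((\<forall>x\<in>S. f differentiable (at x)) \<and> (\<forall>v. Ck_on k (\<lambda>x. frechet_derivative f (at x) v) S))"

definition smooth_on :: "('b::real_normed_vector \<Rightarrow> 'c::real_normed_vector) \<Rightarrow> 'b set \<Rightarrow> bool" where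
  "smooth_on f S \<longleftrightarrow> (\<forall>k. Ck_on k f S)"


section \<open>Smooth manifolds\<close>

text \<open>The underlying space of the manifold is the whole (arbitrary) topological type \<open>'a\<close>. A chart is
  a pair \<open>(U, \<psi>)\<close> of its domain and its coordinate map into the model space \<open>'b\<close>; the values of
  \<open>\<psi>\<close> outside \<open>U\<close> are irrelevant. The dimension is \<open>DIM('b)\<close>.\<close>

type_synonym ('a, 'b) atlas = "('a set \<times> ('a \<Rightarrow> 'b)) set"

definition smooth_manifold ::
    "('a::{t2_space,second_countable_topology}, 'b::euclidean_space) atlas \<Rightarrow> bool" where
  "smooth_manifold A \<longleftrightarrow>
     connected (UNIV :: 'a set) \<and>
     (\<Union>(U, \<psi>)\<in>A. U) = UNIV \<and>
     (\<forall>(U, \<psi>)\<in>A. open U \<and> open (\<psi> ` U) \<and> homeomorphism U (\<psi> ` U) \<psi> (inv_into U \<psi>)) \<and>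
     (\<forall>(U, \<psi>)\<in>A. \<forall>(V, \<theta>)\<in>A. smooth_on (\<theta> \<circ> inv_into U \<psi>) (\<psi> ` (U \<inter> V)))"

definition smooth_fun_on ::
    "('a::topological_space, 'b::euclidean_space) atlas \<Rightarrow> 'a set \<Rightarrow> ('a \<Rightarrow> real) \<Rightarrow> bool" where
  "smooth_fun_on A W h \<longleftrightarrow> (\<forall>(U, \<psi>)\<in>A. smooth_on (h \<circ> inv_into U \<psi>) (\<psi> ` (U \<inter> W)))"

abbreviation smooth_fun ::
    "('a::topological_space, 'b::euclidean_space) atlas \<Rightarrow> ('a \<Rightarrow> real) \<Rightarrow> bool" where
  "smooth_fun A \<equiv> smooth_fun_on A UNIV"


section \<open>Tangent vectors and vector fields\<close>

text \<open>A tangent vector at \<open>p\<close> is a derivation at \<open>p\<close> of the algebra of globally defined smooth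
  functions. As functions in HOL are total, tangent vectors are required to vanish on non-smooth
  functions, so that two derivations agreeing on all smooth functions are equal. Addition and
  subtraction of tangent vectors and of vector fields are the pointwise ones.\<close>

type_synonym 'a tvec = "('a \<Rightarrow> real) \<Rightarrow> real"

definition tscale :: "real \<Rightarrow> 'a tvec \<Rightarrow> 'a tvec" (infixr "*\<^sub>T" 75) where
  "c *\<^sub>T v = (\<lambda>h. c * v h)"

definition tangent_space ::
    "('a::topological_space, 'b::euclidean_space) atlas \<Rightarrow> 'a \<Rightarrow> 'a tvec set" where
  "tangent_space A p = {v.
     (\<forall>h k. smooth_fun A h \<longrightarrow> smooth_fun A k \<longrightarrow> v (\<lambda>x. h x + k x) = v h + v k) \<and>
     (\<forall>c h. smooth_fun A h \<longrightarrow> v (\<lambda>x. c * h x) = c * v h) \<and>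
     (\<forall>h k. smooth_fun A h \<longrightarrow> smooth_fun A k \<longrightarrow> v (\<lambda>x. h x * k x) = v h * k p + h p * v k) \<and>
     (\<forall>h. \<not> smooth_fun A h \<longrightarrow> v h = 0)}"

definition vector_field_on ::
    "('a::topological_space, 'b::euclidean_space) atlas \<Rightarrow> 'a set \<Rightarrow> ('a \<Rightarrow> 'a tvec) \<Rightarrow> bool" where
  "vector_field_on A W X \<longleftrightarrow>
     (\<forall>p\<in>W. X p \<in> tangent_space A p) \<and>
     (\<forall>h. smooth_fun A h \<longrightarrow> smooth_fun_on A W (\<lambda>p. X p h))"

abbreviation vector_field ::
    "('a::topological_space, 'b::euclidean_space) atlas \<Rightarrow> ('a \<Rightarrow> 'a tvec) \<Rightarrow> bool" where
  "vector_field A \<equiv> vector_field_on A UNIV"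

definition deriv_along :: "('a \<Rightarrow> 'a tvec) \<Rightarrow> ('a \<Rightarrow> real) \<Rightarrow> 'a \<Rightarrow> real" where
  "deriv_along X h = (\<lambda>p. X p h)"

definition lie_bracket :: "('a \<Rightarrow> 'a tvec) \<Rightarrow> ('a \<Rightarrow> 'a tvec) \<Rightarrow> 'a \<Rightarrow> 'a tvec" where
  "lie_bracket X Y = (\<lambda>p h. X p (deriv_along Y h) - Y p (deriv_along X h))"


section \<open>Tensor fields\<close>

text \<open>Tensor fields are families of multilinear maps on the tangent spaces, smooth in the sense that
  they send smooth vector fields to smooth functions or smooth vector fields. Their values on
  arguments outside the tangent spaces are irrelevant.\<close>

definition tensor01 ::
    "('a::topological_space, 'b::euclidean_space) atlas \<Rightarrow> ('a \<Rightarrow> 'a tvec \<Rightarrow> real) \<Rightarrow> bool" where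
  "tensor01 A \<omega> \<longleftrightarrow>
     (\<forall>p. \<forall>u\<in>tangent_space A p. \<forall>v\<in>tangent_space A p. \<omega> p (u + v) = \<omega> p u + \<omega> p v) \<and>
     (\<forall>p c. \<forall>v\<in>tangent_space A p. \<omega> p (c *\<^sub>T v) = c * \<omega> p v) \<and>
     (\<forall>X. vector_field A X \<longrightarrow> smooth_fun A (\<lambda>p. \<omega> p (X p)))"

definition tensor11 ::
    "('a::topological_space, 'b::euclidean_space) atlas \<Rightarrow> ('a \<Rightarrow> 'a tvec \<Rightarrow> 'a tvec) \<Rightarrow> bool" where
  "tensor11 A \<Phi> \<longleftrightarrow>
     (\<forall>p. \<forall>v\<in>tangent_space A p. \<Phi> p v \<in> tangent_space A p) \<and>
     (\<forall>p. \<forall>u\<in>tangent_space A p. \<forall>v\<in>tangent_space A p. \<Phi> p (u + v) = \<Phi> p u + \<Phi> p v) \<and>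
     (\<forall>p c. \<forall>v\<in>tangent_space A p. \<Phi> p (c *\<^sub>T v) = c *\<^sub>T \<Phi> p v) \<and>
     (\<forall>X. vector_field A X \<longrightarrow> vector_field A (\<lambda>p. \<Phi> p (X p)))"

definition tensor02 ::
    "('a::topological_space, 'b::euclidean_space) atlas \<Rightarrow> ('a \<Rightarrow> 'a tvec \<Rightarrow> 'a tvec \<Rightarrow> real) \<Rightarrow> bool" where
  "tensor02 A \<alpha> \<longleftrightarrow>
     (\<forall>p. \<forall>u\<in>tangent_space A p. \<forall>v\<in>tangent_space A p. \<forall>w\<in>tangent_space A p.
        \<alpha> p (u + v) w = \<alpha> p u w + \<alpha> p v w \<and> \<alpha> p w (u + v) = \<alpha> p w u + \<alpha> p w v) \<and>
     (\<forall>p c. \<forall>u\<in>tangent_space A p. \<forall>v\<in>tangent_space A p.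
        \<alpha> p (c *\<^sub>T u) v = c * \<alpha> p u v \<and> \<alpha> p u (c *\<^sub>T v) = c * \<alpha> p u v) \<and>
     (\<forall>X Y. vector_field A X \<longrightarrow> vector_field A Y \<longrightarrow> smooth_fun A (\<lambda>p. \<alpha> p (X p) (Y p)))"

definition symmetric_tensor ::
    "('a::topological_space, 'b::euclidean_space) atlas \<Rightarrow> ('a \<Rightarrow> 'a tvec \<Rightarrow> 'a tvec \<Rightarrow> real) \<Rightarrow> bool" where
  "symmetric_tensor A \<alpha> \<longleftrightarrow>
     (\<forall>p. \<forall>u\<in>tangent_space A p. \<forall>v\<in>tangent_space A p. \<alpha> p u v = \<alpha> p v u)"

definition riemannian_metric ::
    "('a::topological_space, 'b::euclidean_space) atlas \<Rightarrow> ('a \<Rightarrow> 'a tvec \<Rightarrow> 'a tvec \<Rightarrow> real) \<Rightarrow> bool" where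
  "riemannian_metric A g \<longleftrightarrow>
     tensor02 A g \<and> symmetric_tensor A g \<and>
     (\<forall>p. \<forall>v\<in>tangent_space A p. v \<noteq> 0 \<longrightarrow> g p v v > 0)"

definition differential :: "('a \<Rightarrow> real) \<Rightarrow> 'a \<Rightarrow> 'a tvec \<Rightarrow> real" where
  "differential f = (\<lambda>p v. v f)"

definition wedge11 ::
    "('a \<Rightarrow> 'a tvec \<Rightarrow> real) \<Rightarrow> ('a \<Rightarrow> 'a tvec \<Rightarrow> real) \<Rightarrow> 'a \<Rightarrow> 'a tvec \<Rightarrow> 'a tvec \<Rightarrow> real" where
  "wedge11 \<omega> \<theta> = (\<lambda>p u v. \<omega> p u * \<theta> p v - \<omega> p v * \<theta> p u)"


section \<open>Connections\<close>

text \<open>\<open>D X Y\<close> stands for the covariant derivative of \<open>Y\<close> along \<open>X\<close>; it is only constrained on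
  smooth vector fields.\<close>

type_synonym 'a conn = "('a \<Rightarrow> 'a tvec) \<Rightarrow> ('a \<Rightarrow> 'a tvec) \<Rightarrow> 'a \<Rightarrow> 'a tvec"

definition affine_connection ::
    "('a::topological_space, 'b::euclidean_space) atlas \<Rightarrow> 'a conn \<Rightarrow> bool" where
  "affine_connection A D \<longleftrightarrow>
     (\<forall>X Y. vector_field A X \<longrightarrow> vector_field A Y \<longrightarrow> vector_field A (D X Y)) \<and>
     (\<forall>X Y Z. vector_field A X \<longrightarrow> vector_field A Y \<longrightarrow> vector_field A Z \<longrightarrow>
        D (X + Y) Z = D X Z + D Y Z \<and> D X (Y + Z) = D X Y + D X Z) \<and>
     (\<forall>h X Y. smooth_fun A h \<longrightarrow> vector_field A X \<longrightarrow> vector_field A Y \<longrightarrow>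
        D (\<lambda>p. h p *\<^sub>T X p) Y = (\<lambda>p. h p *\<^sub>T D X Y p) \<and>
        D X (\<lambda>p. h p *\<^sub>T Y p) = (\<lambda>p. deriv_along X h p *\<^sub>T Y p + h p *\<^sub>T D X Y p))"

definition cov_deriv11 ::
    "'a conn \<Rightarrow> ('a \<Rightarrow> 'a tvec \<Rightarrow> 'a tvec) \<Rightarrow> ('a \<Rightarrow> 'a tvec) \<Rightarrow> ('a \<Rightarrow> 'a tvec) \<Rightarrow> 'a \<Rightarrow> 'a tvec" where
  "cov_deriv11 D \<Phi> X Y = (\<lambda>p. D X (\<lambda>q. \<Phi> q (Y q)) p - \<Phi> p (D X Y p))"

definition cov_deriv02 ::
    "'a conn \<Rightarrow> ('a \<Rightarrow> 'a tvec \<Rightarrow> 'a tvec \<Rightarrow> real) \<Rightarrow>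
      ('a \<Rightarrow> 'a tvec) \<Rightarrow> ('a \<Rightarrow> 'a tvec) \<Rightarrow> ('a \<Rightarrow> 'a tvec) \<Rightarrow> 'a \<Rightarrow> real" where
  "cov_deriv02 D \<alpha> X Y Z = (\<lambda>p.
     deriv_along X (\<lambda>q. \<alpha> q (Y q) (Z q)) p - \<alpha> p (D X Y p) (Z p) - \<alpha> p (Y p) (D X Z p))"

definition parallel_tensor02 ::
    "('a::topological_space, 'b::euclidean_space) atlas \<Rightarrow> 'a conn \<Rightarrow>
      ('a \<Rightarrow> 'a tvec \<Rightarrow> 'a tvec \<Rightarrow> real) \<Rightarrow> bool" where
  "parallel_tensor02 A D \<alpha> \<longleftrightarrow>
     (\<forall>X Y Z. vector_field A X \<longrightarrow> vector_field A Y \<longrightarrow> vector_field A Z \<longrightarrow>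
        (\<forall>p. cov_deriv02 D \<alpha> X Y Z p = 0))"

definition levi_civita ::
    "('a::topological_space, 'b::euclidean_space) atlas \<Rightarrow>
      ('a \<Rightarrow> 'a tvec \<Rightarrow> 'a tvec \<Rightarrow> real) \<Rightarrow> 'a conn \<Rightarrow> bool" where
  "levi_civita A g D \<longleftrightarrow>
     affine_connection A D \<and> parallel_tensor02 A D g \<and>
     (\<forall>X Y. vector_field A X \<longrightarrow> vector_field A Y \<longrightarrow> D X Y - D Y X = lie_bracket X Y)"


section \<open>Almost contact metric and f-Kenmotsu manifolds\<close>

definition almost_contact_metric_manifold ::
    "('a::{t2_space,second_countable_topology}, 'b::euclidean_space) atlas \<Rightarrow>
      ('a \<Rightarrow> 'a tvec \<Rightarrow> 'a tvec) \<Rightarrow> ('a \<Rightarrow> 'a tvec) \<Rightarrow> ('a \<Rightarrow> 'a tvec \<Rightarrow> real) \<Rightarrow>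
      ('a \<Rightarrow> 'a tvec \<Rightarrow> 'a tvec \<Rightarrow> real) \<Rightarrow> bool" where
  "almost_contact_metric_manifold A \<phi> \<xi> \<eta> g \<longleftrightarrow>
     smooth_manifold A \<and> (\<exists>n\<ge>1. DIM('b) = 2 * n + 1) \<and>
     tensor11 A \<phi> \<and> vector_field A \<xi> \<and> tensor01 A \<eta> \<and> riemannian_metric A g \<and>
     (\<forall>p. \<forall>u\<in>tangent_space A p. \<phi> p (\<phi> p u) = - u + \<eta> p u *\<^sub>T \<xi> p) \<and>
     (\<forall>p. \<eta> p (\<xi> p) = 1) \<and>
     (\<forall>p. \<forall>u\<in>tangent_space A p. \<eta> p (\<phi> p u) = 0) \<and>
     (\<forall>p. \<phi> p (\<xi> p) = 0) \<and>
     (\<forall>p. \<forall>u\<in>tangent_space A p. \<eta> p u = g p u (\<xi> p)) \<and>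
     (\<forall>p. \<forall>u\<in>tangent_space A p. \<forall>v\<in>tangent_space A p.
        g p (\<phi> p u) (\<phi> p v) = g p u v - \<eta> p u * \<eta> p v)"

definition f_Kenmotsu_manifold ::
    "('a::{t2_space,second_countable_topology}, 'b::euclidean_space) atlas \<Rightarrow>
      ('a \<Rightarrow> 'a tvec \<Rightarrow> 'a tvec) \<Rightarrow> ('a \<Rightarrow> 'a tvec) \<Rightarrow> ('a \<Rightarrow> 'a tvec \<Rightarrow> real) \<Rightarrow>
      ('a \<Rightarrow> 'a tvec \<Rightarrow> 'a tvec \<Rightarrow> real) \<Rightarrow> 'a conn \<Rightarrow> ('a \<Rightarrow> real) \<Rightarrow> bool" where
  "f_Kenmotsu_manifold A \<phi> \<xi> \<eta> g D f \<longleftrightarrow>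
     almost_contact_metric_manifold A \<phi> \<xi> \<eta> g \<and> levi_civita A g D \<and>
     smooth_fun A f \<and> (\<forall>p. f p > 0) \<and>
     (\<forall>p. \<forall>u\<in>tangent_space A p. \<forall>v\<in>tangent_space A p. wedge11 (differential f) \<eta> p u v = 0) \<and>
     (\<forall>X Y. vector_field A X \<longrightarrow> vector_field A Y \<longrightarrow>
        (\<forall>p. cov_deriv11 D \<phi> X Y p =
           f p *\<^sub>T (g p (\<phi> p (X p)) (Y p) *\<^sub>T \<xi> p - \<eta> p (Y p) *\<^sub>T \<phi> p (X p))))"

definition regular_f_Kenmotsu_manifold ::
    "('a::{t2_space,second_countable_topology}, 'b::euclidean_space) atlas \<Rightarrow>
      ('a \<Rightarrow> 'a tvec \<Rightarrow> 'a tvec) \<Rightarrow> ('a \<Rightarrow> 'a tvec) \<Rightarrow> ('a \<Rightarrow> 'a tvec \<Rightarrow> real) \<Rightarrow>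
      ('a \<Rightarrow> 'a tvec \<Rightarrow> 'a tvec \<Rightarrow> real) \<Rightarrow> 'a conn \<Rightarrow> ('a \<Rightarrow> real) \<Rightarrow> bool" where
  "regular_f_Kenmotsu_manifold A \<phi> \<xi> \<eta> g D f \<longleftrightarrow>
     f_Kenmotsu_manifold A \<phi> \<xi> \<eta> g D f \<and> (\<forall>p. (f p)\<^sup>2 + deriv_along \<xi> f p \<noteq> 0)"


section \<open>Subbundles of the tangent bundle\<close>

text \<open>Subbundles of constant rank \<open>r\<close>, given by their fibres and admitting smooth local frames.\<close>

definition subbundle ::
    "('a::topological_space, 'b::euclidean_space) atlas \<Rightarrow> ('a \<Rightarrow> 'a tvec set) \<Rightarrow> bool" where
  "subbundle A E \<longleftrightarrow>
     (\<exists>r::nat. \<forall>p. \<exists>W F. open W \<and> p \<in> W \<and>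
        (\<forall>i<r. vector_field_on A W (F i)) \<and>
        (\<forall>q\<in>W. E q = {\<Sum>i<r. c i *\<^sub>T F i q | c. True} \<and>
               (\<forall>c. (\<Sum>i<r. c i *\<^sub>T F i q) = 0 \<longrightarrow> (\<forall>i<r. c i = 0))))"

definition nonzero_subbundle :: "('a \<Rightarrow> 'a tvec set) \<Rightarrow> bool" where
  "nonzero_subbundle E \<longleftrightarrow> (\<exists>p. E p \<noteq> {0})"

definition parallel_subbundle ::
    "('a::topological_space, 'b::euclidean_space) atlas \<Rightarrow> 'a conn \<Rightarrow> ('a \<Rightarrow> 'a tvec set) \<Rightarrow> bool" where
  "parallel_subbundle A D E \<longleftrightarrow>
     (\<forall>X Y. vector_field A X \<longrightarrow> vector_field A Y \<longrightarrow> (\<forall>p. Y p \<in> E p) \<longrightarrow> (\<forall>p. D X Y p \<in> E p))"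

definition tangent_direct_sum ::
    "('a::topological_space, 'b::euclidean_space) atlas \<Rightarrow>
      ('a \<Rightarrow> 'a tvec set) \<Rightarrow> ('a \<Rightarrow> 'a tvec set) \<Rightarrow> bool" where
  "tangent_direct_sum A E1 E2 \<longleftrightarrow>
     (\<forall>p. tangent_space A p = {u + w | u w. u \<in> E1 p \<and> w \<in> E2 p} \<and> E1 p \<inter> E2 p = {0})"

end

theory Submission
  imports Defs
begin

text \<open>The structure equations give \<open>\<nabla>\<^sub>X \<xi> = f (X - \<eta>(X) \<xi>)\<close> and, since \<open>df = \<xi>(f) \<eta>\<close>,
  \<open>R(X, Y) \<xi> = (f\<^sup>2 + \<xi>(f)) (\<eta>(X) Y - \<eta>(Y) X)\<close>. For a parallel symmetric \<open>\<alpha>\<close>, skewness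
  \<open>\<alpha>(R(\<xi>, X) \<xi>, \<xi>) = 0\<close> and regularity force \<open>\<alpha>(X, \<xi>) = \<alpha>(\<xi>, \<xi>) \<eta>(X)\<close>; hence \<open>\<alpha>(\<xi>, \<xi>)\<close> is a
  constant \<open>c\<close>, and differentiating \<open>\<alpha>(X, \<xi>) = c \<eta>(X)\<close> gives \<open>\<alpha> = c g\<close>.

  For irreducibility, the smoothness of the projection onto a summand is avoided: the first Bianchi
  identity for \<open>U \<in> E\<^sub>1\<close>, \<open>V \<in> E\<^sub>2\<close>, \<open>\<xi>\<close> shows that nonzero parallel complementary subbundles are both
  orthogonal to \<open>\<xi>\<close>, which is impossible as they span the tangent space.

  Tangent vectors being derivations of global functions, Hadamard's lemma and bump functions are
  needed to extend them to global vector fields.\<close>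

section \<open>Calculus of smooth maps\<close>

lemma Ck_on_Suc_has_derivative:
  "Ck_on (Suc k) f S \<Longrightarrow> x \<in> S \<Longrightarrow> (f has_derivative frechet_derivative f (at x)) (at x)"
  using frechet_derivative_works by auto

text \<open>\<open>frechet_derivative\<close> is taken in the full space, so on an open set equal
  values force equal derivatives and the induction passes to the directional derivatives.\<close>

lemma Ck_on_cong:
  assumes "open S" "\<And>x. x \<in> S \<Longrightarrow> f x = g x" "Ck_on k f S"
  shows "Ck_on k g S"
  using assms(2,3)
proof (induction k arbitrary: f g)
  case 0
  then show ?case by (metis Ck_on.simps(1) continuous_on_cong)
next
  case (Suc k)
  have eq: "frechet_derivative f (at x) = frechet_derivative g (at x)" if "x \<in> S" for x
    using frechet_derivative_transform_within_open[of f x S g] Suc.prems assms(1) that by simp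
  have "g differentiable (at x)" if "x \<in> S" for x
    using has_derivative_transform_within_open[OF _ assms(1) that, of f _ UNIV g]
      Ck_on_Suc_has_derivative[OF Suc.prems(2) that] Suc.prems(1)
    unfolding differentiable_def by blast
  moreover have "Ck_on k (\<lambda>x. frechet_derivative g (at x) v) S" for v
    by (rule Suc.IH[of "\<lambda>x. frechet_derivative f (at x) v"]) (use eq Suc.prems in auto)
  ultimately show ?case by simp
qed

text \<open>Uniqueness of derivatives lets an explicit formula replace the choice operator behind
  \<open>frechet_derivative\<close>; the closure lemmas below argue through this rule.\<close>

lemma Ck_on_SucI:
  assumes "open S" "\<And>x. x \<in> S \<Longrightarrow> (f has_derivative f' x) (at x)" "\<And>v. Ck_on k (\<lambda>x. f' x v) S"
  shows "Ck_on (Suc k) f S"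
proof -
  have eq: "f' x = frechet_derivative f (at x)" if "x \<in> S" for x
    using frechet_derivative_at assms(2) that by blast
  have "Ck_on k (\<lambda>x. frechet_derivative f (at x) v) S" for v
    using Ck_on_cong[OF assms(1) _ assms(3)] eq by force
  then show ?thesis using assms(2) unfolding differentiable_def Ck_on.simps by blast
qed

lemma Ck_on_Suc_imp: "Ck_on (Suc k) f S \<Longrightarrow> Ck_on k f S"
proof (induction k arbitrary: f)
  case 0
  then show ?case
    by (auto intro!: continuous_at_imp_continuous_on differentiable_imp_continuous_within)
next
  case (Suc k)
  then show ?case using Ck_on.simps(2) by metis
qed

lemma Ck_on_subset: "Ck_on k f S \<Longrightarrow> T \<subseteq> S \<Longrightarrow> Ck_on k f T"
  by (induction k arbitrary: f) (auto intro: continuous_on_subset)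

lemma Ck_on_local:
  assumes "\<And>x. x \<in> S \<Longrightarrow> \<exists>T. open T \<and> x \<in> T \<and> Ck_on k f T"
  shows "Ck_on k f S"
  using assms
proof (induction k arbitrary: f)
  case 0
  then show ?case
    by (simp) (metis continuous_at_imp_continuous_on continuous_on_eq_continuous_at)
next
  case (Suc k)
  have "f differentiable (at x)" if "x \<in> S" for x
    using Suc.prems[OF that] by auto
  moreover have "Ck_on k (\<lambda>x. frechet_derivative f (at x) v) S" for v
    by (rule Suc.IH) (use Suc.prems Ck_on.simps(2) in metis)
  ultimately show ?case by simp
qed

lemma Ck_on_const: "Ck_on k (\<lambda>x. c) S"
proof (induction k arbitrary: c)
  case (Suc k)
  have "frechet_derivative (\<lambda>x. c) (at x) = (\<lambda>v. 0)" for x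
    by (simp add: frechet_derivative_const)
  with Suc show ?case by simp
qed simp

lemma Ck_on_bounded_linear_compose:
  assumes "open S" "bounded_linear L" "Ck_on k f S"
  shows "Ck_on k (\<lambda>x. L (f x)) S"
  using assms(3)
proof (induction k arbitrary: f)
  case 0
  then show ?case using assms(2) bounded_linear.continuous_on by auto
next
  case (Suc k)
  show ?case
  proof (rule Ck_on_SucI[OF assms(1)])
    show "((\<lambda>x. L (f x)) has_derivative (\<lambda>v. L (frechet_derivative f (at x) v))) (at x)"
      if "x \<in> S" for x
      using bounded_linear.has_derivative[OF assms(2)] Ck_on_Suc_has_derivative[OF Suc.prems that] .
  qed (use Suc in auto)
qed

lemma Ck_on_bounded_linear:
  assumes "open S" "bounded_linear L" shows "Ck_on k L S"
proof (cases k)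
  case 0
  then show ?thesis using assms bounded_linear.continuous_on[of L S "\<lambda>x. x"] by auto
next
  case (Suc m)
  then show ?thesis
    using Ck_on_SucI[OF assms(1), where f' = "\<lambda>x. L" and f = L]
      Ck_on_const bounded_linear_imp_has_derivative[OF assms(2)] by blast
qed

lemma Ck_on_add:
  assumes "open S" "Ck_on k f S" "Ck_on k g S"
  shows "Ck_on k (\<lambda>x. f x + g x) S"
  using assms(2,3)
proof (induction k arbitrary: f g)
  case 0
  then show ?case by (auto intro: continuous_on_add)
next
  case (Suc k)
  show ?case
    by (rule Ck_on_SucI[OF assms(1), OF has_derivative_add[OF
            Ck_on_Suc_has_derivative[OF Suc.prems(1)] Ck_on_Suc_has_derivative[OF Suc.prems(2)]]])
      (use Suc in auto)
qed

lemma Ck_on_mult: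
  fixes f g :: "'b::real_normed_vector \<Rightarrow> real"
  assumes "open S" "Ck_on k f S" "Ck_on k g S"
  shows "Ck_on k (\<lambda>x. f x * g x) S"
  using assms(2,3)
proof (induction k arbitrary: f g)
  case 0
  then show ?case by (auto intro: continuous_on_mult)
next
  case (Suc k)
  show ?case
    by (rule Ck_on_SucI[OF assms(1), OF has_derivative_mult[OF
            Ck_on_Suc_has_derivative[OF Suc.prems(1)] Ck_on_Suc_has_derivative[OF Suc.prems(2)]]])
      (use Suc.IH Suc.prems[THEN Ck_on_Suc_imp] Suc.prems in \<open>auto intro!: Ck_on_add[OF assms(1)]\<close>)
qed

lemma Ck_on_sum:
  assumes "open S" "\<And>i. i \<in> I \<Longrightarrow> Ck_on k (f i) S"
  shows "Ck_on k (\<lambda>x. \<Sum>i\<in>I. f i x) S"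
  using assms(2)
  by (induction I rule: infinite_finite_induct) (auto intro: Ck_on_const Ck_on_add[OF assms(1)])

text \<open>\<open>Ck_on\<close> controls derivatives in fixed directions only, whereas the chain
  rule differentiates f in a direction that moves with x. Expanding that direction in the basis
  gives a finite sum of products whose factors are covered by the induction hypothesis or by the
  class of \<tau>.\<close>

lemma Ck_on_compose:
  fixes f :: "'c::euclidean_space \<Rightarrow> real" and \<tau> :: "'b::real_normed_vector \<Rightarrow> 'c"
  assumes "open S" "\<tau> ` S \<subseteq> T" "Ck_on k f T" "Ck_on k \<tau> S"
  shows "Ck_on k (\<lambda>x. f (\<tau> x)) S"
  using assms(3,4)
proof (induction k arbitrary: f)
  case 0
  then show ?case using assms(2) continuous_on_compose2 by auto
next
  case (Suc k)
  have 1: "((\<lambda>x. f (\<tau> x)) has_derivative (\<lambda>v. \<Sum>i\<in>Basis.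
      (frechet_derivative \<tau> (at x) v \<bullet> i) * frechet_derivative f (at (\<tau> x)) i)) (at x)"
    if "x \<in> S" for x
  proof -
    have a: "(f has_derivative frechet_derivative f (at (\<tau> x))) (at (\<tau> x))"
      using Ck_on_Suc_has_derivative[OF Suc.prems(1)] that assms(2) by blast
    have "frechet_derivative f (at (\<tau> x)) u = (\<Sum>i\<in>Basis. (u \<bullet> i) * frechet_derivative f (at (\<tau> x)) i)" for u
    proof -
      have "frechet_derivative f (at (\<tau> x)) (\<Sum>i\<in>Basis. (u \<bullet> i) *\<^sub>R i) =
          (\<Sum>i\<in>Basis. (u \<bullet> i) * frechet_derivative f (at (\<tau> x)) i)"
        using has_derivative_linear[OF a] by (simp add: linear_sum linear_cmul)
      then show ?thesis unfolding euclidean_representation .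
    qed
    then have "(\<lambda>v. frechet_derivative f (at (\<tau> x)) (frechet_derivative \<tau> (at x) v)) =
        (\<lambda>v. \<Sum>i\<in>Basis. (frechet_derivative \<tau> (at x) v \<bullet> i) * frechet_derivative f (at (\<tau> x)) i)"
      by blast
    from has_derivative_compose[OF Ck_on_Suc_has_derivative[OF Suc.prems(2) that] a, unfolded this]
    show ?thesis .
  qed
  show ?case
  proof (rule Ck_on_SucI[OF assms(1)])
    show "((\<lambda>x. f (\<tau> x)) has_derivative (\<lambda>v. \<Sum>i\<in>Basis.
      (frechet_derivative \<tau> (at x) v \<bullet> i) * frechet_derivative f (at (\<tau> x)) i)) (at x)"
      if "x \<in> S" for x
      by (rule 1[OF that])
    show "Ck_on k (\<lambda>x. \<Sum>i\<in>Basis. (frechet_derivative \<tau> (at x) v \<bullet> i) *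
      frechet_derivative f (at (\<tau> x)) i) S" for v
    proof (intro Ck_on_sum Ck_on_mult assms(1))
      show "Ck_on k (\<lambda>x. frechet_derivative \<tau> (at x) v \<bullet> i) S" for i
        using Suc.prems(2) by (intro Ck_on_bounded_linear_compose[OF assms(1) bounded_linear_inner_left]) auto
      show "Ck_on k (\<lambda>x. frechet_derivative f (at (\<tau> x)) i) S" for i
        by (rule Suc.IH) (use Suc.prems(1) Ck_on_Suc_imp[OF Suc.prems(2)] in auto)
    qed
  qed
qed

lemma smooth_on_cong:
  "open S \<Longrightarrow> (\<And>x. x \<in> S \<Longrightarrow> f x = g x) \<Longrightarrow> smooth_on f S \<Longrightarrow> smooth_on g S"
  unfolding smooth_on_def using Ck_on_cong by blast

lemma smooth_on_subset: "smooth_on f S \<Longrightarrow> T \<subseteq> S \<Longrightarrow> smooth_on f T"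
  unfolding smooth_on_def using Ck_on_subset by blast

lemma smooth_on_local:
  "(\<And>x. x \<in> S \<Longrightarrow> \<exists>T. open T \<and> x \<in> T \<and> smooth_on f T) \<Longrightarrow> smooth_on f S"
  unfolding smooth_on_def by (intro allI Ck_on_local) blast

lemma smooth_on_const: "smooth_on (\<lambda>x. c) S"
  unfolding smooth_on_def using Ck_on_const by blast

lemma smooth_on_bounded_linear: "open S \<Longrightarrow> bounded_linear L \<Longrightarrow> smooth_on L S"
  unfolding smooth_on_def using Ck_on_bounded_linear by blast

lemma smooth_on_add:
  "open S \<Longrightarrow> smooth_on f S \<Longrightarrow> smooth_on g S \<Longrightarrow> smooth_on (\<lambda>x. f x + g x) S"
  unfolding smooth_on_def using Ck_on_add by blast

lemma smooth_on_mult: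
  fixes f g :: "'b::real_normed_vector \<Rightarrow> real"
  shows "open S \<Longrightarrow> smooth_on f S \<Longrightarrow> smooth_on g S \<Longrightarrow> smooth_on (\<lambda>x. f x * g x) S"
  unfolding smooth_on_def using Ck_on_mult by blast

lemma smooth_on_sum:
  "open S \<Longrightarrow> (\<And>i. i \<in> I \<Longrightarrow> smooth_on (f i) S) \<Longrightarrow> smooth_on (\<lambda>x. \<Sum>i\<in>I. f i x) S"
  unfolding smooth_on_def by (intro allI Ck_on_sum) auto

lemma smooth_on_compose:
  fixes f :: "'c::euclidean_space \<Rightarrow> real" and \<tau> :: "'b::real_normed_vector \<Rightarrow> 'c"
  shows "open S \<Longrightarrow> \<tau> ` S \<subseteq> T \<Longrightarrow> smooth_on f T \<Longrightarrow> smooth_on \<tau> S \<Longrightarrow> smooth_on (\<lambda>x. f (\<tau> x)) S"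
  unfolding smooth_on_def by (intro allI) (rule Ck_on_compose[where T = T], auto)

lemma smooth_on_has_derivative:
  "smooth_on f S \<Longrightarrow> x \<in> S \<Longrightarrow> (f has_derivative frechet_derivative f (at x)) (at x)"
  unfolding smooth_on_def by (intro Ck_on_Suc_has_derivative[of 0]) auto

lemma smooth_on_derivative:
  "smooth_on f S \<Longrightarrow> smooth_on (\<lambda>x. frechet_derivative f (at x) v) S"
  unfolding smooth_on_def
proof
  fix k assume "\<forall>k. Ck_on k f S"
  then have "Ck_on (Suc k) f S" ..
  then show "Ck_on k (\<lambda>x. frechet_derivative f (at x) v) S" by simp
qed

lemma smooth_on_imp_continuous_on: "smooth_on f S \<Longrightarrow> continuous_on S f"
  unfolding smooth_on_def by (metis Ck_on.simps(1))

section \<open>Flat functions and bump functions on Euclidean space\<close>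

lemma exp_neg_inverse_tendsto: "((\<lambda>t. (1/t) ^ n * exp (- (1/t))) \<longlongrightarrow> (0::real)) (at_right 0)"
proof -
  have "((\<lambda>x::real. x ^ n / exp x) \<longlongrightarrow> 0) at_top"
    using tendsto_power_div_exp_0 .
  from filterlim_compose[OF this filterlim_inverse_at_top_right]
  show ?thesis by (simp add: field_simps exp_minus)
qed

text \<open>The case n = 0 is the classical flat function. The family is closed under
  differentiation up to linear combinations, so one induction over all n yields smoothness.\<close>

definition flat_exp :: "nat \<Rightarrow> real \<Rightarrow> real" where
  "flat_exp n t = (if t > 0 then (1/t) ^ n * exp (- (1/t)) else 0)"

lemma flat_exp_has_derivative:
  "(flat_exp n has_real_derivative - real n * flat_exp (Suc n) t + flat_exp (n + 2) t) (at t)"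
proof -
  consider "t < 0" | "t = 0" | "t > 0" by linarith
  then show ?thesis
  proof cases
    case 1
    have "(flat_exp n has_real_derivative 0) (at t)"
      by (rule has_field_derivative_transform_within_open[of "\<lambda>x. 0" _ _ "{..<0}"])
        (use 1 in \<open>auto simp: flat_exp_def\<close>)
    then show ?thesis using 1 by (simp add: flat_exp_def)
  next
    case 2
    \<comment> \<open>For h > 0 the difference quotient at 0 is the expression of index n + 1, which
      tends to 0; from the left it is identically 0.\<close>
    have r: "((\<lambda>h. flat_exp n h / h) \<longlongrightarrow> 0) (at_right 0)"
      by (rule Lim_transform_eventually[OF exp_neg_inverse_tendsto[of "Suc n"]])
        (auto simp: eventually_at_right_field flat_exp_def intro!: exI[of _ 1])
    have l: "((\<lambda>h. flat_exp n h / h) \<longlongrightarrow> 0) (at_left 0)"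
      by (rule Lim_transform_eventually[OF tendsto_const])
        (auto simp: eventually_at_left_field flat_exp_def intro!: exI[of _ "-1"])
    have "((\<lambda>h. flat_exp n h / h) \<longlongrightarrow> 0) (at 0)"
      using filterlim_split_at[OF l r] .
    then show ?thesis using 2 by (simp add: DERIV_def flat_exp_def)
  next
    case 3
    have inv: "((\<lambda>t. 1/t) has_real_derivative - (1/t)\<^sup>2) (at t)"
      using 3 by (auto intro!: derivative_eq_intros simp: power2_eq_square)
    have "((\<lambda>t. exp (- (1/t))) has_real_derivative exp (- (1/t)) * - (- (1/t)\<^sup>2)) (at t)"
      by (rule DERIV_chain2[OF DERIV_exp DERIV_minus[OF inv]])
    note D = DERIV_mult[OF DERIV_power[OF inv, of n] this]
    \<comment> \<open>The truncated exponent \<open>n - Suc 0\<close> is harmless: for n = 0 the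
      factor \<open>real n\<close> vanishes.\<close>
    have "real n * (- (1/t)\<^sup>2 * (1/t) ^ (n - Suc 0)) = - (real n * (1/t) ^ Suc n)"
      by (cases n) (auto simp: power2_eq_square)
    then have "((\<lambda>t. (1/t) ^ n * exp (- (1/t))) has_real_derivative
       - real n * flat_exp (Suc n) t + flat_exp (n + 2) t) (at t)"
      using 3 by (intro DERIV_cong[OF D]) (simp add: flat_exp_def power2_eq_square mult_ac)
    then show ?thesis
      by (rule has_field_derivative_transform_within_open[of _ _ _ "{0<..}"])
        (use 3 in \<open>auto simp: flat_exp_def\<close>)
  qed
qed

lemma smooth_on_flat_exp: "smooth_on (flat_exp n) UNIV"
proof -
  have "Ck_on k (flat_exp n) UNIV" for k
  proof (induction k arbitrary: n)
    case 0
    have "\<forall>x\<in>UNIV. isCont (flat_exp n) x"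
      using DERIV_isCont[OF flat_exp_has_derivative] by blast
    then show ?case
      using continuous_at_imp_continuous_on by auto
  next
    case (Suc k)
    show ?case
    proof (rule Ck_on_SucI)
      show "(flat_exp n has_derivative (\<lambda>v. (- real n * flat_exp (Suc n) x + flat_exp (n + 2) x) * v)) (at x)" for x
        using flat_exp_has_derivative unfolding has_field_derivative_def .
      show "Ck_on k (\<lambda>x. (- real n * flat_exp (Suc n) x + flat_exp (n + 2) x) * v) UNIV" for v
        by (intro Ck_on_mult Ck_on_add Ck_on_const Suc open_UNIV)
    qed auto
  qed
  then show ?thesis unfolding smooth_on_def by blast
qed

lemma smooth_bump_euclidean:
  fixes x0 :: "'b::euclidean_space"
  assumes "r > 0"
  obtains b where "smooth_on b UNIV" "b x0 = (1::real)" "\<And>x. x \<notin> cball x0 r \<Longrightarrow> b x = 0"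
proof
  \<comment> \<open>This is 1 - |x - x0|^2 / r^2, spelled out in coordinates so that the closure
    lemmas apply. Off the ball it is nonpositive and the flat function vanishes; at x0 it is 1, and
    the factor \<open>exp 1\<close> normalises the bump there.\<close>
  let ?q = "\<lambda>x. 1 + (\<Sum>i\<in>Basis. (-1/r\<^sup>2) * ((x \<bullet> i + - (x0 \<bullet> i)) * (x \<bullet> i + - (x0 \<bullet> i))))"
  let ?B = "\<lambda>x. exp 1 * flat_exp 0 (?q x)"
  have sq: "smooth_on ?q (UNIV :: 'b set)"
    by (intro smooth_on_add smooth_on_sum smooth_on_mult smooth_on_const open_UNIV
        smooth_on_bounded_linear[OF open_UNIV bounded_linear_inner_left])
  show "smooth_on ?B UNIV"
    by (rule smooth_on_mult[OF open_UNIV smooth_on_const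
          smooth_on_compose[OF open_UNIV subset_UNIV smooth_on_flat_exp sq]])
  have q: "?q x = 1 - (dist x x0 / r)\<^sup>2" for x
  proof -
    have "(dist x x0)\<^sup>2 = (x - x0) \<bullet> (x - x0)" by (simp add: dist_norm power2_norm_eq_inner)
    also have "\<dots> = (\<Sum>i\<in>Basis. ((x \<bullet> i + - (x0 \<bullet> i)) * (x \<bullet> i + - (x0 \<bullet> i))))"
      by (subst euclidean_inner) (simp add: inner_diff_left)
    finally have "?q x = 1 + (-1/r\<^sup>2) * (dist x x0)\<^sup>2" by (simp only: sum_distrib_left)
    then show ?thesis by (simp only: power_divide) simp
  qed
  show "?B x0 = 1" unfolding q by (simp add: flat_exp_def exp_minus)
  show "?B x = 0" if "x \<notin> cball x0 r" for x
  proof -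
    have "1 \<le> dist x x0 / r" using that assms by (simp add: dist_commute)
    then have "1\<^sup>2 \<le> (dist x x0 / r)\<^sup>2" by (intro power_mono) auto
    then show ?thesis unfolding q by (simp add: flat_exp_def)
  qed
qed

section \<open>Hadamard's lemma\<close>

text \<open>Differentiating under the integral along v brings out a factor t and replaces H by its
  derivative along v. Allowing every weight t^m and every smooth H closes the family, so the
  induction on k goes through.\<close>

lemma Ck_on_integral_segment:
  fixes H :: "'b::euclidean_space \<Rightarrow> real"
  assumes S: "open S" "convex S" "x0 \<in> S" and H: "smooth_on H S"
  shows "Ck_on k (\<lambda>x. integral {0..1} (\<lambda>t. t ^ m * H (x0 + t *\<^sub>R (x - x0)))) S"
  using H
proof (induction k arbitrary: H m)
  have seg: "x0 + t *\<^sub>R (x - x0) \<in> S" if "x \<in> S" "t \<in> {0..1}" for x t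
  proof -
    have "(1 - t) *\<^sub>R x0 + t *\<^sub>R x \<in> S" using S that convexD_alt by fastforce
    then show ?thesis by (simp add: algebra_simps)
  qed
  have cont: "continuous_on (S \<times> {0..1}) (\<lambda>(x, t). t ^ m * H (x0 + t *\<^sub>R (x - x0)))"
    if "continuous_on S H" for H :: "'b \<Rightarrow> real" and m
    unfolding case_prod_beta
    by (intro continuous_intros continuous_on_compose2[OF that]) (auto intro: seg)
  {
    case 0
    from integral_continuous_on_param[OF cont[OF smooth_on_imp_continuous_on[OF 0], unfolded box_real(2)[symmetric]]]
    show ?case by (simp add: box_real)
  next
    case (Suc k)
    have d: "(H has_derivative frechet_derivative H (at x)) (at x)" if "x \<in> S" for x
      using smooth_on_has_derivative[OF Suc.prems that] .
    \<comment> \<open>\<open>leibniz_rule\<close> wants the derivative of the integrand as a bounded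
      linear map, hence \<open>Blinfun\<close>; only values for x in S and t in [0, 1]
      matter.\<close>
    define F where "F x t = Blinfun (\<lambda>v. t ^ m * frechet_derivative H (at (x0 + t *\<^sub>R (x - x0))) (t *\<^sub>R v))" for x t
    have bl: "bounded_linear (frechet_derivative H (at x))" if "x \<in> S" for x
      using d[OF that] has_derivative_bounded_linear by blast
    have F: "blinfun_apply (F x t) = (\<lambda>v. t ^ m * frechet_derivative H (at (x0 + t *\<^sub>R (x - x0))) (t *\<^sub>R v))"
      if "x \<in> S" "t \<in> {0..1}" for x t
      unfolding F_def
      by (intro bounded_linear_Blinfun_apply bounded_linear_mult_const bounded_linear_const_mult
          bounded_linear_compose[OF bl[OF seg[OF that]]] bounded_linear_scaleR_right)
    have F2: "blinfun_apply (F x t) v = t ^ Suc m * frechet_derivative H (at (x0 + t *\<^sub>R (x - x0))) v"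
      if "x \<in> S" "t \<in> {0..1}" for x t v
      using F[OF that] linear_cmul[OF bounded_linear.linear[OF bl[OF seg[OF that]]]] by simp
    have contF: "continuous_on (S \<times> {0..1}) (\<lambda>(x, t). F x t)"
    proof (rule continuous_on_blinfun_componentwise)
      fix i :: 'b
      show "continuous_on (S \<times> {0..1}) (\<lambda>z. blinfun_apply (case z of (x, t) \<Rightarrow> F x t) i)"
        by (rule continuous_on_eq[OF cont[of "\<lambda>x. frechet_derivative H (at x) i" "Suc m",
                OF smooth_on_imp_continuous_on[OF smooth_on_derivative[OF Suc.prems]]]])
          (auto simp: F2)
    qed
    show ?case
    proof (rule Ck_on_SucI[OF S(1)])
      fix x assume x: "x \<in> S"
      have "((\<lambda>x. integral (cbox 0 1) (\<lambda>t. t ^ m * H (x0 + t *\<^sub>R (x - x0)))) has_derivative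
          blinfun_apply (integral (cbox 0 1) (F x))) (at x within S)"
      proof (rule leibniz_rule)
        fix x and t :: real assume xt: "x \<in> S" "t \<in> cbox 0 1"
        have "((\<lambda>x. H (x0 + t *\<^sub>R (x - x0))) has_derivative
           (\<lambda>v. frechet_derivative H (at (x0 + t *\<^sub>R (x - x0))) (t *\<^sub>R v))) (at x within S)"
          by (rule has_derivative_compose[where f = "\<lambda>x. x0 + t *\<^sub>R (x - x0)", OF _ d[OF seg[of x t]]])
            (use xt in \<open>auto intro!: derivative_eq_intros\<close>)
        then show "((\<lambda>x. t ^ m * H (x0 + t *\<^sub>R (x - x0))) has_derivative blinfun_apply (F x t)) (at x within S)"
          using xt by (simp add: F) (intro has_derivative_mult_right)
      next
        fix x assume x: "x \<in> S"
        have "continuous_on {0..1} (\<lambda>t. t ^ m * H (x0 + t *\<^sub>R (x - x0)))"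
          by (intro continuous_intros continuous_on_compose2[OF smooth_on_imp_continuous_on[OF Suc.prems]])
            (use seg x in auto)
        then show "(\<lambda>t. t ^ m * H (x0 + t *\<^sub>R (x - x0))) integrable_on cbox 0 1"
          by (simp add: integrable_continuous_real)
      qed (use contF x S in auto)
      then have 1: "((\<lambda>x. integral {0..1} (\<lambda>t. t ^ m * H (x0 + t *\<^sub>R (x - x0)))) has_derivative
          blinfun_apply (integral {0..1} (F x))) (at x)"
        unfolding at_within_open[OF x S(1)] box_real .
      have "continuous_on {0..1} (\<lambda>t. (\<lambda>(x, t). F x t) (x, t))"
        by (rule continuous_on_compose2[OF contF continuous_on_Pair[OF continuous_on_const continuous_on_id]])
          (use x in auto)
      then have "F x integrable_on {0..1}"
        by (simp add: integrable_continuous_real)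
      then have "blinfun_apply (integral {0..1} (F x)) v =
          integral {0..1} (\<lambda>t. t ^ Suc m * frechet_derivative H (at (x0 + t *\<^sub>R (x - x0))) v)" for v
        using F2[OF x] by (simp only: blinfun_apply_integral) (rule integral_cong)
      then have "blinfun_apply (integral {0..1} (F x)) =
          (\<lambda>v. integral {0..1} (\<lambda>t. t ^ Suc m * frechet_derivative H (at (x0 + t *\<^sub>R (x - x0))) v))"
        by blast
      with 1 show "((\<lambda>x. integral {0..1} (\<lambda>t. t ^ m * H (x0 + t *\<^sub>R (x - x0)))) has_derivative
          (\<lambda>v. integral {0..1} (\<lambda>t. t ^ Suc m * frechet_derivative H (at (x0 + t *\<^sub>R (x - x0))) v))) (at x)"
        by metis
    next
      show "Ck_on k (\<lambda>x. integral {0..1} (\<lambda>t. t ^ Suc m * frechet_derivative H (at (x0 + t *\<^sub>R (x - x0))) v)) S" for v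
        by (rule Suc.IH[OF smooth_on_derivative[OF Suc.prems]])
    qed
  }
qed

text \<open>\<open>G i\<close> is the mean of the i-th partial derivative of h over the segment from
  x0 to x, and the expansion is the fundamental theorem of calculus along that segment. Convexity
  keeps the segment in S.\<close>

lemma Hadamard:
  fixes h :: "'b::euclidean_space \<Rightarrow> real"
  assumes S: "open S" "convex S" "x0 \<in> S" and h: "smooth_on h S"
  obtains G where "\<And>i. smooth_on (G i) S"
    "\<And>x. x \<in> S \<Longrightarrow> h x = h x0 + (\<Sum>i\<in>Basis. ((x - x0) \<bullet> i) * G i x)"
    "\<And>i. G i x0 = frechet_derivative h (at x0) i"
proof
  define G where "G i x = integral {0..1} (\<lambda>t. frechet_derivative h (at (x0 + t *\<^sub>R (x - x0))) i)" for i x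
  have d: "(h has_derivative frechet_derivative h (at x)) (at x)" if "x \<in> S" for x
    using smooth_on_has_derivative[OF h that] .
  show "smooth_on (G i) S" for i
    using Ck_on_integral_segment[OF S smooth_on_derivative[OF h], of _ 0]
    unfolding G_def smooth_on_def by simp
  show "G i x0 = frechet_derivative h (at x0) i" for i by (simp add: G_def)
  fix x assume x: "x \<in> S"
  have seg: "x0 + t *\<^sub>R (x - x0) \<in> S" if "t \<in> {0..1}" for t
  proof -
    have "(1 - t) *\<^sub>R x0 + t *\<^sub>R x \<in> S" using S x that convexD_alt by fastforce
    then show ?thesis by (simp add: algebra_simps)
  qed
  have 1: "((\<lambda>t. h (x0 + t *\<^sub>R (x - x0))) has_vector_derivative
      frechet_derivative h (at (x0 + t *\<^sub>R (x - x0))) (x - x0)) (at t within {0..1})" if "t \<in> {0..1}" for t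
  proof -
    have "((\<lambda>t. h (x0 + t *\<^sub>R (x - x0))) has_derivative
      (\<lambda>s. frechet_derivative h (at (x0 + t *\<^sub>R (x - x0))) (s *\<^sub>R (x - x0)))) (at t within {0..1})"
      by (rule has_derivative_compose[where f = "\<lambda>t. x0 + t *\<^sub>R (x - x0)", OF _ d[OF seg[OF that]]])
        (use that in \<open>auto intro!: derivative_eq_intros\<close>)
    then show ?thesis
      using linear_cmul[OF has_derivative_linear[OF d[OF seg[OF that]]]]
      by (simp add: has_vector_derivative_def)
  qed
  have 2: "frechet_derivative h (at (x0 + t *\<^sub>R (x - x0))) (x - x0) =
      (\<Sum>i\<in>Basis. ((x - x0) \<bullet> i) * frechet_derivative h (at (x0 + t *\<^sub>R (x - x0))) i)" if "t \<in> {0..1}" for t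
  proof -
    have "frechet_derivative h (at (x0 + t *\<^sub>R (x - x0))) (\<Sum>i\<in>Basis. ((x - x0) \<bullet> i) *\<^sub>R i) =
      (\<Sum>i\<in>Basis. ((x - x0) \<bullet> i) * frechet_derivative h (at (x0 + t *\<^sub>R (x - x0))) i)"
      using has_derivative_linear[OF d[OF seg[OF that]]] by (simp add: linear_sum linear_cmul)
    then show ?thesis unfolding euclidean_representation .
  qed
  have int: "(\<lambda>t. frechet_derivative h (at (x0 + t *\<^sub>R (x - x0))) i) integrable_on {0..1}" for i
    by (intro integrable_continuous_real continuous_intros
        continuous_on_compose2[OF smooth_on_imp_continuous_on[OF smooth_on_derivative[OF h]]])
      (use seg in auto)
  have "((\<lambda>t. frechet_derivative h (at (x0 + t *\<^sub>R (x - x0))) (x - x0)) has_integral h x - h x0) {0..1}"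
    using fundamental_theorem_of_calculus[OF zero_le_one 1] by simp
  then have "h x - h x0 = integral {0..1} (\<lambda>t. frechet_derivative h (at (x0 + t *\<^sub>R (x - x0))) (x - x0))"
    by (simp add: integral_unique)
  also have "\<dots> = integral {0..1} (\<lambda>t. \<Sum>i\<in>Basis. ((x - x0) \<bullet> i) * frechet_derivative h (at (x0 + t *\<^sub>R (x - x0))) i)"
    by (rule integral_cong[OF 2])
  also have "\<dots> = (\<Sum>i\<in>Basis. ((x - x0) \<bullet> i) * G i x)"
    unfolding G_def by (subst integral_sum) (auto intro!: integrable_cmul[OF int, unfolded real_scaleR_def])
  finally show "h x = h x0 + (\<Sum>i\<in>Basis. ((x - x0) \<bullet> i) * G i x)" by simp
qed


section \<open>Smooth functions and vector fields on manifolds\<close>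

locale manifold =
  fixes A :: "('a::{t2_space,second_countable_topology}, 'b::euclidean_space) atlas"
  assumes smooth_manifold: "smooth_manifold A"
begin

section \<open>Charts\<close>

lemma chart_covers: obtains U \<psi> where "(U, \<psi>) \<in> A" "p \<in> U"
proof -
  have "p \<in> (\<Union>(U, \<psi>)\<in>A. U)"
    using smooth_manifold unfolding smooth_manifold_def by simp
  then show thesis using that by blast
qed

lemma chart:
  assumes "(U, \<psi>) \<in> A"
  shows chart_open: "open U"
    and chart_open_range: "open (\<psi> ` U)"
    and chart_homeomorphism: "homeomorphism U (\<psi> ` U) \<psi> (inv_into U \<psi>)"
  using assms smooth_manifold unfolding smooth_manifold_def by blast+

lemma chart_transition:
  "(U, \<psi>) \<in> A \<Longrightarrow> (V, \<theta>) \<in> A \<Longrightarrow> smooth_on (\<theta> \<circ> inv_into U \<psi>) (\<psi> ` (U \<inter> V))"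
  using smooth_manifold unfolding smooth_manifold_def by blast

lemma inv_chart [simp]: "(U, \<psi>) \<in> A \<Longrightarrow> q \<in> U \<Longrightarrow> inv_into U \<psi> (\<psi> q) = q"
  using homeomorphism_apply1[OF chart_homeomorphism] .

lemma chart_open_image:
  assumes "(U, \<psi>) \<in> A" "open W"
  shows "open (\<psi> ` (U \<inter> W))"
proof -
  have "openin (top_of_set (\<psi> ` U)) (\<psi> ` (U \<inter> W))"
    by (rule homeomorphism_imp_open_map[OF chart_homeomorphism[OF assms(1)]])
      (use assms(2) in auto)
  then show ?thesis using chart_open_range[OF assms(1)] openin_open_eq by blast
qed

section \<open>Smooth functions on open subsets\<close>

lemma smooth_fun_on_subset: "smooth_fun_on A W h \<Longrightarrow> W' \<subseteq> W \<Longrightarrow> smooth_fun_on A W' h"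
  unfolding smooth_fun_on_def by (blast intro: smooth_on_subset)

lemma smooth_fun_on_cong:
  assumes "open W" "\<And>q. q \<in> W \<Longrightarrow> h q = k q" "smooth_fun_on A W h"
  shows "smooth_fun_on A W k"
  unfolding smooth_fun_on_def
proof safe
  fix U \<psi> assume c: "(U, \<psi>) \<in> A"
  show "smooth_on (k \<circ> inv_into U \<psi>) (\<psi> ` (U \<inter> W))"
    by (rule smooth_on_cong[OF chart_open_image[OF c assms(1)], of "h \<circ> inv_into U \<psi>"])
      (use c assms in \<open>auto simp: smooth_fun_on_def\<close>)
qed

lemma smooth_fun_on_local:
  assumes "\<And>q. q \<in> W \<Longrightarrow> \<exists>W'. open W' \<and> q \<in> W' \<and> smooth_fun_on A W' h"
  shows "smooth_fun_on A W h"
  unfolding smooth_fun_on_def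
proof safe
  fix U \<psi> assume c: "(U, \<psi>) \<in> A"
  show "smooth_on (h \<circ> inv_into U \<psi>) (\<psi> ` (U \<inter> W))"
  proof (rule smooth_on_local)
    fix x assume "x \<in> \<psi> ` (U \<inter> W)"
    then obtain q where q: "q \<in> U" "q \<in> W" "x = \<psi> q" by blast
    obtain W' where W': "open W'" "q \<in> W'" "smooth_fun_on A W' h" using assms[OF q(2)] by blast
    have "smooth_on (h \<circ> inv_into U \<psi>) (\<psi> ` (U \<inter> W'))"
      using W'(3) c unfolding smooth_fun_on_def by blast
    moreover have "x \<in> \<psi> ` (U \<inter> W')" using q W'(2) by blast
    ultimately show "\<exists>T. open T \<and> x \<in> T \<and> smooth_on (h \<circ> inv_into U \<psi>) T"
      using chart_open_image[OF c W'(1)] by blast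
  qed
qed

lemma smooth_fun_on_const: "smooth_fun_on A W (\<lambda>q. c)"
  unfolding smooth_fun_on_def comp_def by (simp add: smooth_on_const split: prod.split)

lemma smooth_fun_on_add:
  assumes "open W" "smooth_fun_on A W h" "smooth_fun_on A W k"
  shows "smooth_fun_on A W (\<lambda>q. h q + k q)"
  unfolding smooth_fun_on_def comp_def
proof safe
  fix U \<psi> assume c: "(U, \<psi>) \<in> A"
  show "smooth_on (\<lambda>x. h (inv_into U \<psi> x) + k (inv_into U \<psi> x)) (\<psi> ` (U \<inter> W))"
    using assms(2,3) c unfolding smooth_fun_on_def comp_def
    by (intro smooth_on_add[OF chart_open_image[OF c assms(1)]]) auto
qed

lemma smooth_fun_on_mult:
  assumes "open W" "smooth_fun_on A W h" "smooth_fun_on A W k"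
  shows "smooth_fun_on A W (\<lambda>q. h q * k q)"
  unfolding smooth_fun_on_def comp_def
proof safe
  fix U \<psi> assume c: "(U, \<psi>) \<in> A"
  show "smooth_on (\<lambda>x. h (inv_into U \<psi> x) * k (inv_into U \<psi> x)) (\<psi> ` (U \<inter> W))"
    using assms(2,3) c unfolding smooth_fun_on_def comp_def
    by (intro smooth_on_mult[OF chart_open_image[OF c assms(1)]]) auto
qed

lemma smooth_fun_on_sum:
  assumes "open W" "\<And>i. i \<in> I \<Longrightarrow> smooth_fun_on A W (h i)"
  shows "smooth_fun_on A W (\<lambda>q. \<Sum>i\<in>I. h i q)"
  using assms(2)
  by (induction I rule: infinite_finite_induct)
    (auto intro: smooth_fun_on_const smooth_fun_on_add[OF assms(1)])

lemmas smooth_fun_const = smooth_fun_on_const[of UNIV]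
lemmas smooth_fun_add = smooth_fun_on_add[OF open_UNIV]
lemmas smooth_fun_mult = smooth_fun_on_mult[OF open_UNIV]
lemmas smooth_fun_sum = smooth_fun_on_sum[OF open_UNIV]

text \<open>Smoothness is tested in every chart of the atlas; smooth transition maps reduce the test
  to the single chart \<psi>.\<close>

lemma smooth_fun_on_chart:
  assumes c: "(U, \<psi>) \<in> A" and W: "open W" "W \<subseteq> U" and F: "smooth_on F (\<psi> ` W)"
  shows "smooth_fun_on A W (\<lambda>q. F (\<psi> q))"
  unfolding smooth_fun_on_def
proof safe
  fix V \<theta> assume d: "(V, \<theta>) \<in> A"
  have "smooth_on (\<lambda>x. F ((\<psi> \<circ> inv_into V \<theta>) x)) (\<theta> ` (V \<inter> W))"
  proof (rule smooth_on_compose[OF chart_open_image[OF d W(1)] _ F])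
    show "(\<psi> \<circ> inv_into V \<theta>) ` \<theta> ` (V \<inter> W) \<subseteq> \<psi> ` W" using d by auto
    show "smooth_on (\<psi> \<circ> inv_into V \<theta>) (\<theta> ` (V \<inter> W))"
      using smooth_on_subset[OF chart_transition[OF d c]] W(2) by (metis Int_mono image_mono order_refl)
  qed
  then show "smooth_on ((\<lambda>q. F (\<psi> q)) \<circ> inv_into V \<theta>) (\<theta> ` (V \<inter> W))" by (simp add: comp_def)
qed

lemma smooth_on_chart_expression:
  assumes "(U, \<psi>) \<in> A" "smooth_fun A h"
  shows "smooth_on (h \<circ> inv_into U \<psi>) (\<psi> ` U)"
  using assms unfolding smooth_fun_on_def by force

section \<open>Bump functions and extension by zero\<close>

text \<open>A Euclidean bump is carried over by a chart. The image K of the closed ball is compact,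
  hence closed in a Hausdorff space, so the bump is 0 on the open set \<open>- K\<close>, which
  together with the chart domain covers everything.\<close>

lemma smooth_bump:
  assumes W: "open W" "p \<in> W"
  obtains b K where "smooth_fun A b" "b p = 1" "closed K" "K \<subseteq> W" "\<And>q. q \<notin> K \<Longrightarrow> b q = 0"
proof -
  obtain U \<psi> where c: "(U, \<psi>) \<in> A" "p \<in> U" using chart_covers .
  have "open (\<psi> ` (U \<inter> W))" "\<psi> p \<in> \<psi> ` (U \<inter> W)"
    using chart_open_image[OF c(1) W(1)] c W by auto
  then obtain r where r: "r > 0" "cball (\<psi> p) r \<subseteq> \<psi> ` (U \<inter> W)"
    using open_contains_cball by meson
  obtain \<beta> where \<beta>: "smooth_on \<beta> UNIV" "\<beta> (\<psi> p) = (1::real)" "\<And>x. x \<notin> cball (\<psi> p) r \<Longrightarrow> \<beta> x = 0"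
    using smooth_bump_euclidean[OF r(1)] by blast
  define K where "K = inv_into U \<psi> ` cball (\<psi> p) r"
  define b where "b q = (if q \<in> U then \<beta> (\<psi> q) else 0)" for q
  have "continuous_on (cball (\<psi> p) r) (inv_into U \<psi>)"
    by (rule continuous_on_subset[OF homeomorphism_cont2[OF chart_homeomorphism[OF c(1)]]])
      (use r(2) in blast)
  then have K: "closed K"
    unfolding K_def by (intro compact_imp_closed compact_continuous_image) auto
  have KW: "K \<subseteq> W" unfolding K_def using r(2) c(1) by force
  have off: "b q = 0" if "q \<notin> K" for q
    using that \<beta>(3)[of "\<psi> q"] inv_chart[OF c(1)] unfolding b_def K_def by (metis image_eqI)
  have "smooth_fun_on A U b"
    by (rule smooth_fun_on_cong[OF chart_open[OF c(1)] _ smooth_fun_on_chart[OF c(1) chart_open[OF c(1)]]])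
      (use smooth_on_subset[OF \<beta>(1)] in \<open>auto simp: b_def\<close>)
  moreover have "smooth_fun_on A (- K) b"
    by (rule smooth_fun_on_cong[OF _ _ smooth_fun_on_const[of _ 0]]) (use K off in auto)
  moreover have "q \<in> U \<or> q \<in> - K" for q
    unfolding K_def using r(2) c(1) by force
  ultimately have "smooth_fun A b"
    using K chart_open[OF c(1)] by (intro smooth_fun_on_local) (meson open_Compl)
  then show thesis using that[of b K] K KW off \<beta>(2) c(2) by (simp add: b_def)
qed

text \<open>W and the complement of K form an open cover: on one the function is a product of smooth
  functions, on the other it is 0. Local data thus become global functions, the only ones on which
  derivations act.\<close>

lemma smooth_fun_extend:
  assumes W: "open W" and F: "smooth_fun_on A W F"
    and b: "smooth_fun A b" "closed K" "K \<subseteq> W" "\<And>q. q \<notin> K \<Longrightarrow> b q = 0"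
  shows "smooth_fun A (\<lambda>q. if q \<in> W then b q * F q else 0)" (is "smooth_fun A ?h")
proof (rule smooth_fun_on_local)
  fix q
  have "smooth_fun_on A W ?h"
    by (rule smooth_fun_on_cong[OF W _ smooth_fun_on_mult[OF W smooth_fun_on_subset[OF b(1)] F]]) auto
  moreover have "smooth_fun_on A (- K) ?h"
    by (rule smooth_fun_on_cong[OF _ _ smooth_fun_on_const[of _ 0]]) (use b in auto)
  ultimately show "\<exists>W'. open W' \<and> q \<in> W' \<and> smooth_fun_on A W' ?h"
    using W b(2,3) by (cases "q \<in> W") auto
qed

section \<open>Tangent vectors as derivations, and vector fields\<close>

lemma tangent_spaceD:
  assumes "v \<in> tangent_space A p"
  shows tangent_add: "\<And>h k. smooth_fun A h \<Longrightarrow> smooth_fun A k \<Longrightarrow> v (\<lambda>x. h x + k x) = v h + v k"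
    and tangent_cmult: "\<And>c h. smooth_fun A h \<Longrightarrow> v (\<lambda>x. c * h x) = c * v h"
    and tangent_mult: "\<And>h k. smooth_fun A h \<Longrightarrow> smooth_fun A k \<Longrightarrow>
      v (\<lambda>x. h x * k x) = v h * k p + h p * v k"
    and tangent_nonsmooth: "\<And>h. \<not> smooth_fun A h \<Longrightarrow> v h = 0"
  using assms unfolding tangent_space_def by blast+

text \<open>The Leibniz rule for 1 * 1 = 1 gives v(1) = 2 v(1).\<close>

lemma tangent_const:
  assumes "v \<in> tangent_space A p" shows "v (\<lambda>x. c) = 0"
  using tangent_mult[OF assms smooth_fun_const[of 1] smooth_fun_const[of 1]]
    tangent_cmult[OF assms smooth_fun_const[of 1], of c] by simp

lemma tangent_diff:
  assumes "v \<in> tangent_space A p" "smooth_fun A h" "smooth_fun A k"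
  shows "v (\<lambda>x. h x - k x) = v h - v k"
  using tangent_add[OF assms(1,2) smooth_fun_mult[OF smooth_fun_const[of "-1"] assms(3)]]
    tangent_cmult[OF assms(1,3), of "-1"] by simp

lemma tangent_sum:
  assumes "v \<in> tangent_space A p" "\<And>i. i \<in> I \<Longrightarrow> smooth_fun A (h i)"
  shows "v (\<lambda>x. \<Sum>i\<in>I. h i x) = (\<Sum>i\<in>I. v (h i))"
  using assms(2)
proof (induction I rule: infinite_finite_induct)
  case (insert i I)
  then show ?case
    using tangent_add[OF assms(1), of "h i" "\<lambda>x. \<Sum>i\<in>I. h i x"] smooth_fun_sum[of I h] by simp
qed (simp_all add: tangent_const[OF assms(1)])

lemma tangent_space_zero: "0 \<in> tangent_space A p"
  unfolding tangent_space_def by simp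

lemma tangent_space_add:
  "u \<in> tangent_space A p \<Longrightarrow> v \<in> tangent_space A p \<Longrightarrow> u + v \<in> tangent_space A p"
  unfolding tangent_space_def by (auto simp: algebra_simps)

lemma tangent_space_scale: "v \<in> tangent_space A p \<Longrightarrow> c *\<^sub>T v \<in> tangent_space A p"
  unfolding tangent_space_def tscale_def by (auto simp: algebra_simps)

lemma tangent_space_sum:
  "(\<And>i. i \<in> I \<Longrightarrow> v i \<in> tangent_space A p) \<Longrightarrow> (\<Sum>i\<in>I. v i) \<in> tangent_space A p"
  by (induction I rule: infinite_finite_induct) (auto intro: tangent_space_zero tangent_space_add)

lemma vector_fieldD:
  assumes "vector_field A X"
  shows vector_field_tangent: "X p \<in> tangent_space A p"
    and vector_field_smooth: "smooth_fun A h \<Longrightarrow> smooth_fun A (\<lambda>p. X p h)"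
  using assms unfolding vector_field_on_def by auto

lemma vector_field_zero: "vector_field A 0"
  unfolding vector_field_on_def using tangent_space_zero smooth_fun_const[of 0] by simp

lemma vector_field_add: "vector_field A X \<Longrightarrow> vector_field A Y \<Longrightarrow> vector_field A (X + Y)"
  unfolding vector_field_on_def using tangent_space_add smooth_fun_add by simp

lemma vector_field_scale:
  "smooth_fun A h \<Longrightarrow> vector_field A X \<Longrightarrow> vector_field A (\<lambda>p. h p *\<^sub>T X p)"
  unfolding vector_field_on_def using tangent_space_scale smooth_fun_mult by (simp add: tscale_def)

lemma vector_field_diff:
  assumes "vector_field A X" "vector_field A Y" shows "vector_field A (X - Y)"
proof -
  have eq: "X - Y = X + (\<lambda>p. -1 *\<^sub>T Y p)" by (simp add: fun_eq_iff tscale_def)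
  show ?thesis
    unfolding eq by (rule vector_field_add[OF assms(1) vector_field_scale[OF smooth_fun_const assms(2)]])
qed

lemma deriv_along_smooth:
  "vector_field A X \<Longrightarrow> smooth_fun A h \<Longrightarrow> smooth_fun A (deriv_along X h)"
  unfolding deriv_along_def by (rule vector_field_smooth)

text \<open>With a bump function \<open>b\<close> around \<open>p\<close>, Hadamard's lemma expresses \<open>b\<^sup>2 (h - h p)\<close> as a sum of
  products of globally smooth functions, to which the derivation can be applied.\<close>

lemma tangent_coordinates:
  assumes c: "(U, \<psi>) \<in> A" "p \<in> U" and v: "v \<in> tangent_space A p"
  obtains a where "\<And>h. smooth_fun A h \<Longrightarrow> v h = frechet_derivative (h \<circ> inv_into U \<psi>) (at (\<psi> p)) a"
proof -
  obtain r where r: "r > 0" "ball (\<psi> p) r \<subseteq> \<psi> ` U"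
    using chart_open_range[OF c(1)] c(2) open_contains_ball by blast
  let ?B = "ball (\<psi> p) r"
  define W where "W = U \<inter> \<psi> -` ?B"
  have W: "open W" "p \<in> W" "W \<subseteq> U"
    using continuous_open_preimage[OF homeomorphism_cont1[OF chart_homeomorphism[OF c(1)]] chart_open[OF c(1)] open_ball]
      r(1) c(2) unfolding W_def by auto
  have WB: "\<psi> ` W = ?B" unfolding W_def using r(2) by auto
  obtain b K where b: "smooth_fun A b" "b p = 1" "closed K" "K \<subseteq> W" "\<And>q. q \<notin> K \<Longrightarrow> b q = 0"
    using smooth_bump[OF W(1,2)] by blast
  have bW: "b q = 0" if "q \<notin> W" for q using that b(4,5) by blast
  have ext: "smooth_fun A (\<lambda>q. if q \<in> W then b q * F (\<psi> q) else 0)" if "smooth_on F ?B" for F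
    by (rule smooth_fun_extend[OF W(1) smooth_fun_on_chart[OF c(1) W(1,3)] b(1,3,4,5)])
      (use that WB in auto)
  \<comment> \<open>Cut-off coordinate functions, globally smooth and zero at p; the values of v on
    them are the components of the vector sought.\<close>
  define x where "x i q = (if q \<in> W then b q * ((\<psi> q - \<psi> p) \<bullet> i) else 0)" for i q
  have "smooth_on (\<lambda>z. z \<bullet> i + - (\<psi> p \<bullet> i)) ?B" for i
    by (intro smooth_on_add smooth_on_const open_ball
        smooth_on_bounded_linear[OF open_ball bounded_linear_inner_left])
  then have "smooth_on (\<lambda>z. (z - \<psi> p) \<bullet> i) ?B" for i by (simp add: inner_diff_left)
  then have x: "smooth_fun A (x i)" for i unfolding x_def by (rule ext)
  show thesis
  proof
    fix h assume h: "smooth_fun A h"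
    let ?h = "h \<circ> inv_into U \<psi>"
    have hB: "smooth_on ?h ?B"
      using smooth_on_subset[OF smooth_on_chart_expression[OF c(1) h] r(2)] .
    obtain G where G: "\<And>i. smooth_on (G i) ?B"
      "\<And>z. z \<in> ?B \<Longrightarrow> ?h z = ?h (\<psi> p) + (\<Sum>i\<in>Basis. ((z - \<psi> p) \<bullet> i) * G i z)"
      "\<And>i. G i (\<psi> p) = frechet_derivative ?h (at (\<psi> p)) i"
      using Hadamard[OF open_ball convex_ball _ hB, of "\<psi> p"] r(1) by auto
    define y where "y i q = (if q \<in> W then b q * G i (\<psi> q) else 0)" for i q
    have y: "smooth_fun A (y i)" for i unfolding y_def by (rule ext[OF G(1)])
    have "(b q * b q) * h q = h p * (b q * b q) + (\<Sum>i\<in>Basis. x i q * y i q)" for q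
    proof (cases "q \<in> W")
      case True
      then have "h q = h p + (\<Sum>i\<in>Basis. ((\<psi> q - \<psi> p) \<bullet> i) * G i (\<psi> q))"
        using G(2)[of "\<psi> q"] inv_chart[OF c(1)] c(2) unfolding WB[symmetric]
        by (simp add: subsetD[OF W(3)])
      then show ?thesis
        using True by (simp add: x_def y_def algebra_simps sum_distrib_left)
    qed (simp add: x_def y_def bW)
    then have eq: "v (\<lambda>q. (b q * b q) * h q) = v (\<lambda>q. h p * (b q * b q) + (\<Sum>i\<in>Basis. x i q * y i q))"
      by presburger
    have 1: "v (\<lambda>q. h p * (b q * b q)) = h p * v (\<lambda>q. b q * b q)"
      by (rule tangent_cmult[OF v smooth_fun_mult[OF b(1) b(1)]])
    have 2: "v (\<lambda>q. \<Sum>i\<in>Basis. x i q * y i q) = (\<Sum>i\<in>Basis. v (\<lambda>q. x i q * y i q))"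
      by (rule tangent_sum[OF v smooth_fun_mult[OF x y]])
    have S: "smooth_fun A (\<lambda>q. \<Sum>i\<in>Basis. x i q * y i q)"
      by (rule smooth_fun_sum[OF smooth_fun_mult[OF x y]])
    note eq
    also note tangent_add[OF v smooth_fun_mult[OF smooth_fun_const smooth_fun_mult[OF b(1) b(1)]] S]
    also note 1
    also note 2
    \<comment> \<open>As b(p) = 1, the Leibniz rule leaves v(h) and the term h(p) v(b^2), which also
      stands on the other side and cancels.\<close>
    also have "v (\<lambda>q. (b q * b q) * h q) = v (\<lambda>q. b q * b q) * h p + v h"
      using tangent_mult[OF v smooth_fun_mult[OF b(1) b(1)] h] b(2) by simp
    finally have "v h = (\<Sum>i\<in>Basis. v (\<lambda>q. x i q * y i q))" by simp
    \<comment> \<open>\<open>x i\<close> vanishes at p, so only the term with v applied to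
      \<open>x i\<close> survives, and \<open>y i\<close> at p is the i-th partial
      derivative.\<close>
    also have "\<dots> = (\<Sum>i\<in>Basis. v (x i) * frechet_derivative ?h (at (\<psi> p)) i)"
      using tangent_mult[OF v x y] W(2) b(2) G(3) by (simp add: x_def y_def)
    also have "\<dots> = frechet_derivative ?h (at (\<psi> p)) (\<Sum>i\<in>Basis. v (x i) *\<^sub>R i)"
      using has_derivative_linear[OF smooth_on_has_derivative[OF hB]] r(1)
      by (simp add: linear_sum linear_cmul)
    finally show "v h = frechet_derivative ?h (at (\<psi> p)) (\<Sum>i\<in>Basis. v (x i) *\<^sub>R i)" .
  qed
qed

text \<open>The field is the constant coordinate field in direction a, multiplied by a bump
  function.\<close>

lemma coordinate_vector_field:
  assumes c: "(U, \<psi>) \<in> A" "p \<in> U"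
  obtains X where "vector_field A X"
    "\<And>h. smooth_fun A h \<Longrightarrow> X p h = frechet_derivative (h \<circ> inv_into U \<psi>) (at (\<psi> p)) a"
proof -
  note U = chart_open[OF c(1)]
  obtain b K where b: "smooth_fun A b" "b p = 1" "closed K" "K \<subseteq> U" "\<And>q. q \<notin> K \<Longrightarrow> b q = 0"
    using smooth_bump[OF U c(2)] by blast
  let ?d = "\<lambda>h q. frechet_derivative (h \<circ> inv_into U \<psi>) (at (\<psi> q)) a"
  \<comment> \<open>Zero off U makes the field global; zero on non-smooth h is the convention built
    into \<open>tangent_space\<close>.\<close>
  define X where "X q h = (if smooth_fun A h then if q \<in> U then b q * ?d h q else 0 else 0)" for q h
  have D: "(h \<circ> inv_into U \<psi> has_derivative frechet_derivative (h \<circ> inv_into U \<psi>) (at (\<psi> q))) (at (\<psi> q))"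
    if "smooth_fun A h" "q \<in> U" for h q
    using smooth_on_has_derivative[OF smooth_on_chart_expression[OF c(1) that(1)]] that(2) by blast
  have add: "?d (\<lambda>x. h x + k x) q = ?d h q + ?d k q"
    if "smooth_fun A h" "smooth_fun A k" "q \<in> U" for h k q
    using frechet_derivative_at[OF has_derivative_add[OF D[OF that(1,3)] D[OF that(2,3)]]]
    by (simp add: comp_def fun_eq_iff)
  have mult: "?d (\<lambda>x. h x * k x) q = ?d h q * k q + h q * ?d k q"
    if "smooth_fun A h" "smooth_fun A k" "q \<in> U" for h k q
    using fun_cong[OF frechet_derivative_at[OF has_derivative_mult[OF D[OF that(1,3)] D[OF that(2,3)]]], of a]
      that(3) c(1)
    by (simp add: comp_def)
  have const: "?d (\<lambda>x. r) q = 0" for r q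
    by (simp add: comp_def frechet_derivative_const)
  have cmult: "?d (\<lambda>x. r * h x) q = r * ?d h q" if "smooth_fun A h" "q \<in> U" for r h q
    using mult[OF smooth_fun_const that] const by simp
  have "X q \<in> tangent_space A q" for q
    unfolding tangent_space_def X_def
    by (auto simp: smooth_fun_add smooth_fun_mult smooth_fun_const add mult cmult algebra_simps)
  moreover have "smooth_fun A (\<lambda>q. X q h)" if h: "smooth_fun A h" for h
    using smooth_fun_extend[OF U smooth_fun_on_chart[OF c(1) U subset_refl
          smooth_on_derivative[OF smooth_on_chart_expression[OF c(1) h]]] b(1,3,4,5)] h
    by (simp add: X_def)
  ultimately have "vector_field A X" unfolding vector_field_on_def by simp
  then show thesis using that[of X] c(2) b(2) by (simp add: X_def)
qed

text \<open>In a chart v is a directional derivative, and the cut-off coordinate field in that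
  direction agrees with it at p. Pointwise claims are thereby reduced to claims on global
  fields.\<close>

lemma tangent_extend:
  assumes "v \<in> tangent_space A p"
  obtains X where "vector_field A X" "X p = v"
proof -
  obtain U \<psi> where c: "(U, \<psi>) \<in> A" "p \<in> U" using chart_covers .
  obtain a where a: "\<And>h. smooth_fun A h \<Longrightarrow> v h = frechet_derivative (h \<circ> inv_into U \<psi>) (at (\<psi> p)) a"
    using tangent_coordinates[OF c assms] by blast
  obtain X where X: "vector_field A X"
    "\<And>h. smooth_fun A h \<Longrightarrow> X p h = frechet_derivative (h \<circ> inv_into U \<psi>) (at (\<psi> p)) a"
    using coordinate_vector_field[OF c] by blast
  have "X p h = v h" for h
    using a[of h] X(2)[of h] tangent_nonsmooth[OF assms] tangent_nonsmooth[OF vector_field_tangent[OF X(1)]]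
    by (cases "smooth_fun A h") auto
  then show thesis using that X(1) by blast
qed

text \<open>Coordinate fields realise every directional derivative in a chart, so h is constant on
  coordinate balls; connectedness does the rest.\<close>

lemma smooth_fun_constant:
  assumes h: "smooth_fun A h" and zero: "\<And>X p. vector_field A X \<Longrightarrow> X p h = 0"
  shows "h p = h q"
proof (rule connected_local_const[of UNIV p q h])
  show "connected (UNIV :: 'a set)" using smooth_manifold unfolding smooth_manifold_def by blast
  show "\<forall>p\<in>UNIV. eventually (\<lambda>q. h p = h q) (at p within UNIV)"
  proof
    fix p
    obtain U \<psi> where c: "(U, \<psi>) \<in> A" "p \<in> U" using chart_covers .
    obtain r where r: "r > 0" "ball (\<psi> p) r \<subseteq> \<psi> ` U"
      using chart_open_range[OF c(1)] c(2) open_contains_ball by blast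
    let ?B = "ball (\<psi> p) r" and ?h = "h \<circ> inv_into U \<psi>"
    have "(?h has_derivative (\<lambda>v. 0)) (at x within ?B)" if x: "x \<in> ?B" for x
    proof -
      obtain q where q: "q \<in> U" "x = \<psi> q" using x r(2) by blast
      have "frechet_derivative ?h (at x) v = 0" for v
        using coordinate_vector_field[OF c(1) q(1), of v] zero h q(2) by metis
      then have "frechet_derivative ?h (at x) = (\<lambda>v. 0)" by blast
      with smooth_on_has_derivative[OF smooth_on_chart_expression[OF c(1) h], of x]
      show ?thesis using q by (auto intro: has_derivative_at_withinI)
    qed
    from has_derivative_zero_constant[OF convex_ball this]
    obtain k where k: "\<And>x. x \<in> ?B \<Longrightarrow> ?h x = k" by blast
    have "open (U \<inter> \<psi> -` ?B)" "p \<in> U \<inter> \<psi> -` ?B"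
      using continuous_open_preimage[OF homeomorphism_cont1[OF chart_homeomorphism[OF c(1)]] chart_open[OF c(1)] open_ball]
        r(1) c(2) by auto
    moreover have "h q = k" if "q \<in> U \<inter> \<psi> -` ?B" for q
      using k[of "\<psi> q"] that c(1) by simp
    ultimately show "eventually (\<lambda>q. h p = h q) (at p within UNIV)"
      unfolding eventually_at_topological by metis
  qed
qed auto

section \<open>Subbundles and their sections\<close>

lemma sum_tvec_apply: "(\<Sum>i\<in>I. v i) (h :: 'a \<Rightarrow> real) = (\<Sum>i\<in>I. v i h :: real)"
  by (induction I rule: infinite_finite_induct) auto

text \<open>Isolates the condition inside \<open>subbundle\<close>, so that one rank can be fixed
  before the points vary.\<close>

definition local_frame ::
    "('a \<Rightarrow> 'a tvec set) \<Rightarrow> nat \<Rightarrow> 'a set \<Rightarrow> (nat \<Rightarrow> 'a \<Rightarrow> 'a tvec) \<Rightarrow> bool" where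
  "local_frame E r W F \<longleftrightarrow>
     open W \<and> (\<forall>i<r. vector_field_on A W (F i)) \<and>
     (\<forall>q\<in>W. E q = {\<Sum>i<r. c i *\<^sub>T F i q | c. True} \<and>
            (\<forall>c. (\<Sum>i<r. c i *\<^sub>T F i q) = 0 \<longrightarrow> (\<forall>i<r. c i = 0)))"

lemma local_frameD:
  assumes "local_frame E r W F"
  shows "open W"
    and "\<And>i. i < r \<Longrightarrow> vector_field_on A W (F i)"
    and "\<And>q. q \<in> W \<Longrightarrow> E q = {\<Sum>i<r. c i *\<^sub>T F i q | c. True}"
    and "\<And>q c i. q \<in> W \<Longrightarrow> (\<Sum>i<r. c i *\<^sub>T F i q) = 0 \<Longrightarrow> i < r \<Longrightarrow> c i = 0"
  using assms unfolding local_frame_def by simp_all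

lemma subbundle_local_frame:
  assumes "subbundle A E"
  obtains r where "\<forall>p. \<exists>W F. p \<in> W \<and> local_frame E r W F"
proof -
  have "\<exists>r. \<forall>p. \<exists>W F. p \<in> W \<and> local_frame E r W F"
    using assms unfolding subbundle_def local_frame_def by (simp add: conj_left_commute)
  then show thesis using that by blast
qed

lemma subbundle_subspace:
  assumes "subbundle A E"
  shows subbundle_zero: "0 \<in> E p"
    and subbundle_add: "u \<in> E p \<Longrightarrow> v \<in> E p \<Longrightarrow> u + v \<in> E p"
    and subbundle_scale: "u \<in> E p \<Longrightarrow> t *\<^sub>T u \<in> E p"
proof -
  obtain r where r: "\<forall>p. \<exists>W F. p \<in> W \<and> local_frame E r W F"
    using subbundle_local_frame[OF assms] .
  obtain W F where "p \<in> W" "local_frame E r W F" using r[THEN spec, of p] by blast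
  then have E: "E p = {\<Sum>i<r. c i *\<^sub>T F i p | c. True}" by (intro local_frameD)
  have "0 = (\<Sum>i<r. 0 *\<^sub>T F i p)" by (simp add: tscale_def fun_eq_iff sum_tvec_apply)
  then show "0 \<in> E p" unfolding E by (intro CollectI exI[of _ "\<lambda>i. 0"]) simp
  show "u + v \<in> E p" if "u \<in> E p" "v \<in> E p"
  proof -
    obtain c d where "u = (\<Sum>i<r. c i *\<^sub>T F i p)" "v = (\<Sum>i<r. d i *\<^sub>T F i p)" using \<open>u \<in> E p\<close> \<open>v \<in> E p\<close> unfolding E by blast
    then have "u + v = (\<Sum>i<r. (c i + d i) *\<^sub>T F i p)"
      by (simp add: fun_eq_iff sum_tvec_apply tscale_def sum.distrib algebra_simps)
    then show ?thesis unfolding E by (intro CollectI exI[of _ "\<lambda>i. c i + d i"]) simp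
  qed
  show "t *\<^sub>T u \<in> E p" if "u \<in> E p"
  proof -
    obtain c where "u = (\<Sum>i<r. c i *\<^sub>T F i p)" using \<open>u \<in> E p\<close> unfolding E by blast
    then have "t *\<^sub>T u = (\<Sum>i<r. (t * c i) *\<^sub>T F i p)"
      by (simp add: fun_eq_iff sum_tvec_apply tscale_def sum_distrib_left mult.assoc)
    then show ?thesis unfolding E by (intro CollectI exI[of _ "\<lambda>i. t * c i"]) simp
  qed
qed

lemma subbundle_diff:
  assumes "subbundle A E" "u \<in> E p" "v \<in> E p"
  shows "u - v \<in> E p"
proof -
  have "u - v = u + (- 1) *\<^sub>T v" by (simp add: fun_eq_iff tscale_def)
  then show ?thesis using subbundle_add[OF assms(1,2) subbundle_scale[OF assms(1,3)]] by metis
qed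

text \<open>The rank is constant: one nonzero fibre makes it positive, and then the sum of the
  independent frame vectors at p is nonzero.\<close>

lemma subbundle_nonzero:
  assumes "subbundle A E" "nonzero_subbundle E"
  obtains u where "u \<in> E p" "u \<noteq> 0"
proof -
  obtain r where r: "\<forall>p. \<exists>W F. p \<in> W \<and> local_frame E r W F"
    using subbundle_local_frame[OF assms(1)] .
  obtain q where q: "E q \<noteq> {0}" using assms(2) unfolding nonzero_subbundle_def by blast
  have "r \<noteq> 0"
  proof
    assume "r = 0"
    moreover obtain W F where "q \<in> W" "local_frame E r W F" using r[THEN spec, of q] by blast
    ultimately have "E q = {0}" using local_frameD(3)[of E r W F q] by simp
    with q show False by blast
  qed
  obtain W F where F: "p \<in> W" "local_frame E r W F" using r[THEN spec, of p] by blast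
  have "(\<Sum>i<r. 1 *\<^sub>T F i p) \<in> E p"
    unfolding local_frameD(3)[OF F(2,1)] by (intro CollectI exI[of _ "\<lambda>i. 1"]) simp
  moreover have "(\<Sum>i<r. 1 *\<^sub>T F i p) \<noteq> 0" 
    using local_frameD(4)[OF F(2,1), of "\<lambda>i. 1" 0] \<open>r \<noteq> 0\<close> by auto
  ultimately show thesis using that by blast
qed

text \<open>The section has constant coefficients in a local frame near p, is cut off by a bump and
  extended by zero, which lies in every fibre.\<close>

lemma subbundle_section_extend:
  assumes E: "subbundle A E" and u: "u \<in> E p"
  obtains Y where "vector_field A Y" "\<And>q. Y q \<in> E q" "Y p = u"
proof -
  obtain r where r: "\<forall>p. \<exists>W F. p \<in> W \<and> local_frame E r W F"
    using subbundle_local_frame[OF E] .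
  obtain W F where WF: "p \<in> W" "local_frame E r W F" using r[THEN spec, of p] by blast
  then have W: "open W" "p \<in> W" and F: "\<And>i. i < r \<Longrightarrow> vector_field_on A W (F i)"
    and EW: "\<And>q. q \<in> W \<Longrightarrow> E q = {\<Sum>i<r. c i *\<^sub>T F i q | c. True}"
    using local_frameD by blast+
  obtain c where c: "u = (\<Sum>i<r. c i *\<^sub>T F i p)" using u EW[OF W(2)] by blast
  obtain b K where b: "smooth_fun A b" "b p = 1" "closed K" "K \<subseteq> W" "\<And>q. q \<notin> K \<Longrightarrow> b q = 0"
    using smooth_bump[OF W] by blast
  let ?Z = "\<lambda>q. \<Sum>i<r. c i *\<^sub>T F i q"
  define Y where "Y q = (if q \<in> W then b q *\<^sub>T ?Z q else 0)" for q
  have Z: "?Z q \<in> tangent_space A q" if "q \<in> W" for q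
    using F that unfolding vector_field_on_def
    by (intro tangent_space_sum tangent_space_scale) auto
  have "Y q \<in> tangent_space A q" for q
    unfolding Y_def using Z tangent_space_scale tangent_space_zero by auto
  moreover have "smooth_fun A (\<lambda>q. Y q h)" if h: "smooth_fun A h" for h
  proof -
    have "smooth_fun_on A W (\<lambda>q. \<Sum>i<r. c i * F i q h)"
      using F h unfolding vector_field_on_def
      by (intro smooth_fun_on_sum[OF W(1)] smooth_fun_on_mult[OF W(1)] smooth_fun_on_const) auto
    from smooth_fun_extend[OF W(1) this b(1,3,4,5)]
    have "smooth_fun A (\<lambda>q. if q \<in> W then b q * (\<Sum>i<r. c i * F i q h) else 0)" .
    moreover have "(\<lambda>q. Y q h) = (\<lambda>q. if q \<in> W then b q * (\<Sum>i<r. c i * F i q h) else 0)"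
      by (simp add: Y_def fun_eq_iff tscale_def sum_tvec_apply)
    ultimately show ?thesis by simp
  qed
  ultimately have "vector_field A Y" unfolding vector_field_on_def by simp
  moreover have "Y q \<in> E q" for q
  proof (cases "q \<in> W")
    case True
    then have "?Z q \<in> E q" using EW by blast
    then show ?thesis using subbundle_scale[OF E] True by (simp add: Y_def)
  qed (simp add: Y_def subbundle_zero[OF E])
  moreover have "Y p = u" using W(2) b(2) c by (simp add: Y_def tscale_def fun_eq_iff)
  ultimately show thesis using that by blast
qed

end


section \<open>Curvature\<close>

definition curvature ::
    "'a conn \<Rightarrow> ('a \<Rightarrow> 'a tvec) \<Rightarrow> ('a \<Rightarrow> 'a tvec) \<Rightarrow> ('a \<Rightarrow> 'a tvec) \<Rightarrow> 'a \<Rightarrow> 'a tvec" where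
  "curvature D X Y Z = D X (D Y Z) - D Y (D X Z) - D (lie_bracket X Y) Z"

lemma tscale_apply [simp]: "(c *\<^sub>T v) h = c * v h"
  by (simp add: tscale_def)

locale torsion_free_connection = manifold A
  for A :: "('a::{t2_space,second_countable_topology}, 'b::euclidean_space) atlas" +
  fixes D :: "'a conn"
  assumes affine: "affine_connection A D"
    and torsion_free: "\<And>X Y. vector_field A X \<Longrightarrow> vector_field A Y \<Longrightarrow> D X Y - D Y X = lie_bracket X Y"
begin

section \<open>Covariant derivatives, Jacobi identity and first Bianchi identity\<close>

lemma
  assumes "vector_field A X" "vector_field A Y"
  shows D_vector_field: "vector_field A (D X Y)"
    and D_add_right: "\<And>Z. vector_field A Z \<Longrightarrow> D X (Y + Z) = D X Y + D X Z"
    and D_scale_right: "\<And>h. smooth_fun A h \<Longrightarrow>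
      D X (\<lambda>p. h p *\<^sub>T Y p) = (\<lambda>p. deriv_along X h p *\<^sub>T Y p + h p *\<^sub>T D X Y p)"
  using affine assms unfolding affine_connection_def by simp_all

lemma D_diff_right:
  assumes "vector_field A X" "vector_field A Y" "vector_field A Z"
  shows "D X (Y - Z) = D X Y - D X Z"
  using D_add_right[OF assms(1) vector_field_diff[OF assms(2,3)] assms(3)] by simp

lemma D_zero_right: "vector_field A X \<Longrightarrow> D X 0 = 0"
  using D_add_right[OF _ vector_field_zero vector_field_zero, of X] by simp

text \<open>Torsion-freeness writes the bracket as a difference of covariant derivatives, which
  replaces a check of the Leibniz rule.\<close>

lemma lie_bracket_vector_field:
  "vector_field A X \<Longrightarrow> vector_field A Y \<Longrightarrow> vector_field A (lie_bracket X Y)"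
  using torsion_free vector_field_diff D_vector_field by metis

text \<open>On smooth functions brackets are commutators of operators and the terms cancel in pairs.
  On other functions the sum vanishes because its values are tangent vectors.\<close>

lemma jacobi:
  assumes X: "vector_field A X" and Y: "vector_field A Y" and Z: "vector_field A Z"
  shows "lie_bracket X (lie_bracket Y Z) + lie_bracket Y (lie_bracket Z X) + lie_bracket Z (lie_bracket X Y) = 0"
proof (intro ext)
  fix p h
  have l: "U p (deriv_along (lie_bracket V W) h) =
      U p (deriv_along V (deriv_along W h)) - U p (deriv_along W (deriv_along V h))"
    if "vector_field A U" "vector_field A V" "vector_field A W" "smooth_fun A h" for U V W
    using tangent_diff[OF vector_field_tangent[OF that(1)]
        deriv_along_smooth[OF that(2) deriv_along_smooth[OF that(3,4)]]
        deriv_along_smooth[OF that(3) deriv_along_smooth[OF that(2,4)]], of p]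
    by (simp add: deriv_along_def lie_bracket_def)
  let ?S = "lie_bracket X (lie_bracket Y Z) + lie_bracket Y (lie_bracket Z X) + lie_bracket Z (lie_bracket X Y)"
  have S: "vector_field A ?S" by (intro vector_field_add lie_bracket_vector_field assms)
  show "?S p h = 0 p h"
  proof (cases "smooth_fun A h")
    case True
    have "?S p h = X p (deriv_along (lie_bracket Y Z) h) - lie_bracket Y Z p (deriv_along X h)
       + (Y p (deriv_along (lie_bracket Z X) h) - lie_bracket Z X p (deriv_along Y h))
       + (Z p (deriv_along (lie_bracket X Y) h) - lie_bracket X Y p (deriv_along Z h))"
      by (simp add: lie_bracket_def)
    also have "\<dots> = 0" unfolding l[OF X Y Z True] l[OF Y Z X True] l[OF Z X Y True]
      by (simp add: lie_bracket_def)
    finally show ?thesis by simp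
  next
    case False
    then show ?thesis using tangent_nonsmooth[OF vector_field_tangent[OF S]] by simp
  qed
qed

text \<open>Torsion-freeness turns each double bracket into two second covariant derivatives and a
  derivative along a bracket; regrouping the Jacobi identity gives the cyclic sum.\<close>

lemma first_Bianchi:
  assumes X: "vector_field A X" and Y: "vector_field A Y" and Z: "vector_field A Z"
  shows "curvature D X Y Z + curvature D Y Z X + curvature D Z X Y = 0"
proof -
  have l: "lie_bracket U (lie_bracket V W) = D U (D V W) - D U (D W V) - D (lie_bracket V W) U"
    if "vector_field A U" "vector_field A V" "vector_field A W" for U V W
    using torsion_free[OF that(1) lie_bracket_vector_field[OF that(2,3)]]
      D_diff_right[OF that(1) D_vector_field[OF that(2,3)] D_vector_field[OF that(3,2)]]
      torsion_free[OF that(2,3)]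
    by simp
  show ?thesis
    using jacobi[OF assms] unfolding l[OF X Y Z] l[OF Y Z X] l[OF Z X Y] curvature_def
    by (simp add: algebra_simps)
qed

section \<open>Bilinear tensor fields and skewness of the curvature\<close>

lemma tensor02D:
  assumes "tensor02 A \<alpha>" "u \<in> tangent_space A p" "v \<in> tangent_space A p" "w \<in> tangent_space A p"
  shows tensor02_add_left: "\<alpha> p (u + v) w = \<alpha> p u w + \<alpha> p v w"
    and tensor02_add_right: "\<alpha> p w (u + v) = \<alpha> p w u + \<alpha> p w v"
    and tensor02_scale_left: "\<And>c. \<alpha> p (c *\<^sub>T u) w = c * \<alpha> p u w"
    and tensor02_scale_right: "\<And>c. \<alpha> p w (c *\<^sub>T u) = c * \<alpha> p w u"
  using assms unfolding tensor02_def by blast+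

lemma tensor02_diff_left:
  assumes "tensor02 A \<alpha>" "u \<in> tangent_space A p" "v \<in> tangent_space A p" "w \<in> tangent_space A p"
  shows "\<alpha> p (u - v) w = \<alpha> p u w - \<alpha> p v w"
proof -
  have "u - v = u + -1 *\<^sub>T v" by (simp add: fun_eq_iff)
  then have "\<alpha> p (u - v) w = \<alpha> p (u + -1 *\<^sub>T v) w" by (rule arg_cong[where f = "\<lambda>x. \<alpha> p x w"])
  then show ?thesis
    using tensor02_add_left[OF assms(1,2) tangent_space_scale[OF assms(3)] assms(4), of "-1"]
      tensor02_scale_left[OF assms(1,3,4,4), of "-1"] by simp
qed

lemma tensor02_smooth:
  "tensor02 A \<alpha> \<Longrightarrow> vector_field A X \<Longrightarrow> vector_field A Y \<Longrightarrow> smooth_fun A (\<lambda>p. \<alpha> p (X p) (Y p))"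
  unfolding tensor02_def by blast

lemma parallel_deriv:
  assumes "parallel_tensor02 A D \<alpha>" "vector_field A X" "vector_field A Y" "vector_field A Z"
  shows "X p (\<lambda>q. \<alpha> q (Y q) (Z q)) = \<alpha> p (D X Y p) (Z p) + \<alpha> p (Y p) (D X Z p)"
proof -
  have "cov_deriv02 D \<alpha> X Y Z p = 0" using assms unfolding parallel_tensor02_def by blast
  then show ?thesis unfolding cov_deriv02_def deriv_along_def by simp
qed

text \<open>The operator XY - YX - [X, Y] kills the function \<alpha>(Z, Z). Expanding by
  parallelism, the mixed terms in \<nabla>_X Z and \<nabla>_Y Z cancel by symmetry and 2
  \<alpha>(R(X, Y)Z, Z) remains. It is applied to the given tensor and to g.\<close>

lemma curvature_skew:
  assumes \<alpha>: "tensor02 A \<alpha>" "symmetric_tensor A \<alpha>" "parallel_tensor02 A D \<alpha>"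
    and X: "vector_field A X" and Y: "vector_field A Y" and Z: "vector_field A Z"
  shows "\<alpha> p (curvature D X Y Z p) (Z p) = 0"
proof -
  let ?N = "\<lambda>q. \<alpha> q (Z q) (Z q)"
  have sym: "\<alpha> q (U q) (V q) = \<alpha> q (V q) (U q)" if "vector_field A U" "vector_field A V" for U V q
    using \<alpha>(2) vector_field_tangent that unfolding symmetric_tensor_def by blast
  have 1: "deriv_along U ?N = (\<lambda>q. 2 * \<alpha> q (D U Z q) (Z q))" if U: "vector_field A U" for U
    using parallel_deriv[OF \<alpha>(3) U Z Z] sym[OF D_vector_field[OF U Z] Z]
    by (simp add: deriv_along_def fun_eq_iff)
  have 2: "V p (deriv_along U ?N) = 2 * (\<alpha> p (D V (D U Z) p) (Z p) + \<alpha> p (D U Z p) (D V Z p))"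
    if U: "vector_field A U" and V: "vector_field A V" for U V
    unfolding 1[OF U]
    using tangent_cmult[OF vector_field_tangent[OF V] tensor02_smooth[OF \<alpha>(1) D_vector_field[OF U Z] Z], of p 2]
      parallel_deriv[OF \<alpha>(3) V D_vector_field[OF U Z] Z, of p] by simp
  have "2 * \<alpha> p (D (lie_bracket X Y) Z p) (Z p) = lie_bracket X Y p ?N"
    using 1[OF lie_bracket_vector_field[OF X Y]] by (metis deriv_along_def)
  also have "\<dots> = X p (deriv_along Y ?N) - Y p (deriv_along X ?N)"
    by (simp add: lie_bracket_def)
  also have "\<dots> = 2 * (\<alpha> p (D X (D Y Z) p) (Z p) - \<alpha> p (D Y (D X Z) p) (Z p))"
    unfolding 2[OF X Y] 2[OF Y X] using sym[OF D_vector_field[OF X Z] D_vector_field[OF Y Z], of p] by simp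
  finally have 3: "\<alpha> p (D X (D Y Z) p) (Z p) - \<alpha> p (D Y (D X Z) p) (Z p) - \<alpha> p (D (lie_bracket X Y) Z p) (Z p) = 0"
    by simp
  have t: "D X (D Y Z) p \<in> tangent_space A p" "D Y (D X Z) p \<in> tangent_space A p"
    "D (lie_bracket X Y) Z p \<in> tangent_space A p" "Z p \<in> tangent_space A p"
    by (intro vector_field_tangent D_vector_field lie_bracket_vector_field X Y Z)+
  have "D X (D Y Z) p - D Y (D X Z) p \<in> tangent_space A p"
    using vector_field_tangent[OF vector_field_diff[OF D_vector_field[OF X D_vector_field[OF Y Z]]
          D_vector_field[OF Y D_vector_field[OF X Z]]], of p] by simp
  then show ?thesis
    using 3 tensor02_diff_left[OF \<alpha>(1) _ t(3,4)] tensor02_diff_left[OF \<alpha>(1) t(1,2,4)]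
    unfolding curvature_def by simp
qed

end

section \<open>Regular f-Kenmotsu manifolds\<close>

locale regular_f_Kenmotsu =
  fixes A :: "('a::{t2_space,second_countable_topology}, 'b::euclidean_space) atlas"
    and \<phi> :: "'a \<Rightarrow> 'a tvec \<Rightarrow> 'a tvec"
    and \<xi> :: "'a \<Rightarrow> 'a tvec"
    and \<eta> :: "'a \<Rightarrow> 'a tvec \<Rightarrow> real"
    and g :: "'a \<Rightarrow> 'a tvec \<Rightarrow> 'a tvec \<Rightarrow> real"
    and D :: "'a conn"
    and f :: "'a \<Rightarrow> real"
  assumes regular: "regular_f_Kenmotsu_manifold A \<phi> \<xi> \<eta> g D f"
begin

lemma f_Kenmotsu: "f_Kenmotsu_manifold A \<phi> \<xi> \<eta> g D f"
  using regular unfolding regular_f_Kenmotsu_manifold_def by blast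

lemma almost_contact: "almost_contact_metric_manifold A \<phi> \<xi> \<eta> g"
  and Levi_Civita: "levi_civita A g D"
  and f_smooth: "smooth_fun A f"
  and f_pos: "f p > 0"
  and Kenmotsu: "\<And>X Y. vector_field A X \<Longrightarrow> vector_field A Y \<Longrightarrow> cov_deriv11 D \<phi> X Y p =
           f p *\<^sub>T (g p (\<phi> p (X p)) (Y p) *\<^sub>T \<xi> p - \<eta> p (Y p) *\<^sub>T \<phi> p (X p))"
  using f_Kenmotsu unfolding f_Kenmotsu_manifold_def by blast+

sublocale torsion_free_connection A D
  using almost_contact Levi_Civita
  by unfold_locales (auto simp: almost_contact_metric_manifold_def levi_civita_def)

lemma xi_vector_field: "vector_field A \<xi>"
  and g_tensor: "tensor02 A g"
  and g_symmetric: "symmetric_tensor A g"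
  and phi_tensor: "tensor11 A \<phi>"
  and phi_phi: "u \<in> tangent_space A p \<Longrightarrow> \<phi> p (\<phi> p u) = - u + \<eta> p u *\<^sub>T \<xi> p"
  and eta_xi: "\<eta> p (\<xi> p) = 1"
  and eta_phi: "u \<in> tangent_space A p \<Longrightarrow> \<eta> p (\<phi> p u) = 0"
  and phi_xi: "\<phi> p (\<xi> p) = 0"
  and eta_eq: "u \<in> tangent_space A p \<Longrightarrow> \<eta> p u = g p u (\<xi> p)"
  using almost_contact unfolding almost_contact_metric_manifold_def riemannian_metric_def by blast+

lemma g_pos: "v \<in> tangent_space A p \<Longrightarrow> v \<noteq> 0 \<Longrightarrow> g p v v > 0"
  using almost_contact unfolding almost_contact_metric_manifold_def riemannian_metric_def by blast

lemma g_parallel: "parallel_tensor02 A D g"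
  using Levi_Civita unfolding levi_civita_def by blast

lemma xi_tangent: "\<xi> p \<in> tangent_space A p"
  by (rule vector_field_tangent[OF xi_vector_field])

lemma phi_tangent: "u \<in> tangent_space A p \<Longrightarrow> \<phi> p u \<in> tangent_space A p"
  and phi_scale: "u \<in> tangent_space A p \<Longrightarrow> \<phi> p (c *\<^sub>T u) = c *\<^sub>T \<phi> p u"
  using phi_tensor unfolding tensor11_def by blast+

lemma g_xi_xi: "g p (\<xi> p) (\<xi> p) = 1"
  using eta_eq[OF xi_tangent] eta_xi by simp

section \<open>Covariant derivative and curvature of \<xi>\<close>

lemma f_deriv:
  assumes "u \<in> tangent_space A p"
  shows "u f = \<xi> p f * g p u (\<xi> p)"
proof -
  \<comment> \<open>Evaluating on u and \<xi> isolates df(u), as \<eta>(\<xi>) = 1.\<close>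
  have "wedge11 (differential f) \<eta> p u (\<xi> p) = 0"
    using f_Kenmotsu assms xi_tangent unfolding f_Kenmotsu_manifold_def by blast
  then show ?thesis
    using eta_xi eta_eq[OF assms] by (simp add: wedge11_def differential_def)
qed

lemma regularity: "(f p)\<^sup>2 + \<xi> p f \<noteq> 0"
  using regular unfolding regular_f_Kenmotsu_manifold_def deriv_along_def by blast

text \<open>Since \<phi> \<xi> = 0, the Kenmotsu equation for X, \<xi> gives \<phi>(\<nabla>_X
  \<xi>) = f \<phi> X. Applying \<phi> again determines \<nabla>_X \<xi> up to a multiple of \<xi>,
  which g(\<xi>, \<xi>) = 1 fixes. The right-hand side is a sum of scaled fields, ready for
  \<open>D_add_right\<close> and \<open>D_scale_right\<close>.\<close>

lemma D_xi:
  assumes X: "vector_field A X"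
  shows "D X \<xi> = (\<lambda>p. f p *\<^sub>T X p) + (\<lambda>p. (- 1 * (f p * g p (X p) (\<xi> p))) *\<^sub>T \<xi> p)"
proof
  fix p
  let ?w = "D X \<xi> p"
  have w: "?w \<in> tangent_space A p" and Xp: "X p \<in> tangent_space A p"
    using vector_field_tangent D_vector_field X xi_vector_field by blast+
  have "(\<lambda>q. \<phi> q (\<xi> q)) = 0" using phi_xi by (simp add: fun_eq_iff)
  then have "- \<phi> p ?w = f p *\<^sub>T (g p (\<phi> p (X p)) (\<xi> p) *\<^sub>T \<xi> p - \<eta> p (\<xi> p) *\<^sub>T \<phi> p (X p))"
    using Kenmotsu[OF X xi_vector_field, of p] D_zero_right[OF X] by (simp add: cov_deriv11_def)
  moreover have "g p (\<phi> p (X p)) (\<xi> p) = 0"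
    using eta_eq[OF phi_tangent[OF Xp]] eta_phi[OF Xp] by simp
  ultimately have "- \<phi> p ?w h = - (f p * \<phi> p (X p) h)" for h
    using eta_xi[of p] by (simp add: fun_eq_iff)
  then have "\<phi> p ?w = f p *\<^sub>T \<phi> p (X p)" by (simp add: fun_eq_iff)
  then have "\<phi> p (\<phi> p ?w) = f p *\<^sub>T \<phi> p (\<phi> p (X p))"
    using phi_scale[OF phi_tangent[OF Xp]] by simp
  then have 1: "- ?w + \<eta> p ?w *\<^sub>T \<xi> p = f p *\<^sub>T (- X p + \<eta> p (X p) *\<^sub>T \<xi> p)"
    unfolding phi_phi[OF w] phi_phi[OF Xp] .
  have "0 = X p (\<lambda>q. g q (\<xi> q) (\<xi> q))"
    unfolding g_xi_xi using tangent_const[OF Xp] by simp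
  also have "\<dots> = g p ?w (\<xi> p) + g p (\<xi> p) ?w"
    by (rule parallel_deriv[OF g_parallel X xi_vector_field xi_vector_field])
  also have "\<dots> = 2 * \<eta> p ?w"
    using g_symmetric w xi_tangent eta_eq[OF w] unfolding symmetric_tensor_def by simp
  finally have "\<eta> p ?w = 0" by simp
  with 1 have "- ?w h = f p * (- X p h + g p (X p) (\<xi> p) * \<xi> p h)" for h
    using eta_eq[OF Xp] by (simp add: fun_eq_iff)
  then show "D X \<xi> p = ((\<lambda>p. f p *\<^sub>T X p) + (\<lambda>p. (- 1 * (f p * g p (X p) (\<xi> p))) *\<^sub>T \<xi> p)) p"
    by (simp add: fun_eq_iff algebra_simps)
qed

text \<open>The common formula through which \<alpha> and g are compared in
  \<open>parallel_symmetric_tensor\<close>.\<close>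

lemma tensor_D_xi:
  assumes "tensor02 A \<alpha>" "vector_field A X" "v \<in> tangent_space A p"
  shows "\<alpha> p v (D X \<xi> p) = f p * (\<alpha> p v (X p) - g p (X p) (\<xi> p) * \<alpha> p v (\<xi> p))"
proof -
  have Xp: "X p \<in> tangent_space A p" by (rule vector_field_tangent[OF assms(2)])
  have "\<alpha> p v (f p *\<^sub>T X p + c *\<^sub>T \<xi> p) = f p * \<alpha> p v (X p) + c * \<alpha> p v (\<xi> p)" for c
    unfolding tensor02_add_right[OF assms(1) tangent_space_scale[OF Xp] tangent_space_scale[OF xi_tangent] assms(3)]
      tensor02_scale_right[OF assms(1) Xp Xp assms(3)]
      tensor02_scale_right[OF assms(1) xi_tangent Xp assms(3)] ..
  then show ?thesis unfolding D_xi[OF assms(2)] plus_fun_apply by (simp only:) (simp add: algebra_simps)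
qed

lemma curvature_xi:
  assumes X: "vector_field A X" and Y: "vector_field A Y"
  shows "curvature D X Y \<xi> p = ((f p)\<^sup>2 + \<xi> p f) *\<^sub>T
    (g p (X p) (\<xi> p) *\<^sub>T Y p - g p (Y p) (\<xi> p) *\<^sub>T X p)"
proof
  fix h
  let ?e = "\<lambda>X p. g p (X p) (\<xi> p)"
  have sym: "g p (X p) (Y p) = g p (Y p) (X p)"
    using g_symmetric vector_field_tangent X Y unfolding symmetric_tensor_def by blast
  \<comment> \<open>Here df = \<xi>(f) \<eta> is inserted. After exchanging X and Y and subtracting,
    the symmetric terms along \<xi> cancel, those with \<nabla>_X Y are absorbed by the bracket
    term, and the rest has the factor f^2 + \<xi>(f).\<close>
  have DD: "D X (D Y \<xi>) p h = \<xi> p f * ?e X p * Y p h + f p * D X Y p h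
      - (\<xi> p f * ?e X p * ?e Y p + f p * (g p (D X Y p) (\<xi> p) + f p * (g p (Y p) (X p) - ?e X p * ?e Y p))) * \<xi> p h
      - f p * ?e Y p * (f p * X p h - f p * ?e X p * \<xi> p h)"
    if X: "vector_field A X" and Y: "vector_field A Y" for X Y
  proof -
    have e: "smooth_fun A (?e Y)" by (rule tensor02_smooth[OF g_tensor Y xi_vector_field])
    let ?s = "\<lambda>p. - 1 * (f p * ?e Y p)"
    have s: "smooth_fun A ?s" by (intro smooth_fun_mult smooth_fun_const f_smooth e)
    have "D X (D Y \<xi>) = D X (\<lambda>p. f p *\<^sub>T Y p) + D X (\<lambda>p. ?s p *\<^sub>T \<xi> p)"
      unfolding D_xi[OF Y]
      by (rule D_add_right[OF X vector_field_scale[OF f_smooth Y] vector_field_scale[OF s xi_vector_field]])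
    also have "\<dots> = (\<lambda>p. deriv_along X f p *\<^sub>T Y p + f p *\<^sub>T D X Y p)
        + (\<lambda>p. deriv_along X ?s p *\<^sub>T \<xi> p + ?s p *\<^sub>T D X \<xi> p)"
      unfolding D_scale_right[OF X Y f_smooth] D_scale_right[OF X xi_vector_field s] ..
    finally have 1: "D X (D Y \<xi>) p h = X p f * Y p h + f p * D X Y p h + (X p ?s * \<xi> p h + ?s p * D X \<xi> p h)"
      by (simp add: deriv_along_def)
    have Xp: "X p \<in> tangent_space A p" by (rule vector_field_tangent[OF X])
    have Xs: "X p ?s = - 1 * (X p f * ?e Y p + f p * X p (?e Y))"
      unfolding tangent_cmult[OF Xp smooth_fun_mult[OF f_smooth e]] tangent_mult[OF Xp f_smooth e] ..
    have Xe: "X p (?e Y) = g p (D X Y p) (\<xi> p) + f p * (g p (Y p) (X p) - ?e X p * ?e Y p)"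
      unfolding parallel_deriv[OF g_parallel X Y xi_vector_field]
        tensor_D_xi[OF g_tensor X vector_field_tangent[OF Y]] ..
    have Dxi: "D X \<xi> p h = f p * X p h - f p * ?e X p * \<xi> p h"
      unfolding D_xi[OF X] by simp
    show ?thesis unfolding 1 Xs Xe Dxi f_deriv[OF Xp] by (simp add: algebra_simps)
  qed
  have "D (lie_bracket X Y) \<xi> p h = f p * lie_bracket X Y p h - f p * ?e (lie_bracket X Y) p * \<xi> p h"
    unfolding D_xi[OF lie_bracket_vector_field[OF X Y]] by simp
  moreover have "lie_bracket X Y p = D X Y p - D Y X p"
    using torsion_free[OF X Y] by (metis fun_diff_def)
  moreover have "g p (D X Y p - D Y X p) (\<xi> p) = ?e (D X Y) p - ?e (D Y X) p"
    by (intro tensor02_diff_left[OF g_tensor] vector_field_tangent D_vector_field X Y xi_vector_field)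
  ultimately have "D (lie_bracket X Y) \<xi> p h =
      f p * (D X Y p h - D Y X p h) - f p * (?e (D X Y) p - ?e (D Y X) p) * \<xi> p h"
    by simp
  then show "curvature D X Y \<xi> p h = (((f p)\<^sup>2 + \<xi> p f) *\<^sub>T (?e X p *\<^sub>T Y p - ?e Y p *\<^sub>T X p)) h"
    unfolding curvature_def using DD[OF X Y] DD[OF Y X] sym
    by (simp add: algebra_simps power2_eq_square)
qed

section \<open>Parallel symmetric tensors\<close>

theorem parallel_symmetric_tensor:
  assumes \<alpha>: "tensor02 A \<alpha>" "symmetric_tensor A \<alpha>" "parallel_tensor02 A D \<alpha>"
  shows "\<exists>c. \<forall>p. \<forall>u\<in>tangent_space A p. \<forall>v\<in>tangent_space A p. \<alpha> p u v = c * g p u v"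
proof -
  let ?h = "\<lambda>p. \<alpha> p (\<xi> p) (\<xi> p)"
  have xi: "\<alpha> p v (\<xi> p) = g p v (\<xi> p) * ?h p" if v: "v \<in> tangent_space A p" for p v
  proof -
    obtain X where X: "vector_field A X" "X p = v" using tangent_extend[OF v] .
    have "0 = \<alpha> p (curvature D \<xi> X \<xi> p) (\<xi> p)"
      by (rule curvature_skew[OF \<alpha> xi_vector_field X(1) xi_vector_field, symmetric])
    \<comment> \<open>By regularity this is a nonzero multiple of the part of v orthogonal to \<xi>;
      the coefficient 1 is g(\<xi>, \<xi>).\<close>
    also have "curvature D \<xi> X \<xi> p = ((f p)\<^sup>2 + \<xi> p f) *\<^sub>T (1 *\<^sub>T v - g p v (\<xi> p) *\<^sub>T \<xi> p)"
      unfolding curvature_xi[OF xi_vector_field X(1)] g_xi_xi X(2) ..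
    also have "\<alpha> p \<dots> (\<xi> p) = ((f p)\<^sup>2 + \<xi> p f) * (\<alpha> p v (\<xi> p) - g p v (\<xi> p) * ?h p)"
    proof -
      have t: "1 *\<^sub>T v \<in> tangent_space A p" "g p v (\<xi> p) *\<^sub>T \<xi> p \<in> tangent_space A p"
        using v xi_tangent tangent_space_scale by blast+
      have "1 *\<^sub>T v - g p v (\<xi> p) *\<^sub>T \<xi> p = 1 *\<^sub>T v + (- g p v (\<xi> p)) *\<^sub>T \<xi> p"
        by (simp add: fun_eq_iff)
      then have "1 *\<^sub>T v - g p v (\<xi> p) *\<^sub>T \<xi> p \<in> tangent_space A p"
        using v xi_tangent tangent_space_scale tangent_space_add by metis
      then show ?thesis
        using tensor02_scale_left[OF \<alpha>(1) _ xi_tangent xi_tangent]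
          tensor02_diff_left[OF \<alpha>(1) t xi_tangent] tensor02_scale_left[OF \<alpha>(1) v xi_tangent xi_tangent, of 1]
          tensor02_scale_left[OF \<alpha>(1) xi_tangent xi_tangent xi_tangent] by simp
    qed
    finally show ?thesis using regularity[of p] by simp
  qed
  have sym: "\<alpha> p u v = \<alpha> p v u" if "u \<in> tangent_space A p" "v \<in> tangent_space A p" for p u v
    using \<alpha>(2) that unfolding symmetric_tensor_def by blast
  have "?h p = ?h q" for p q
  proof (rule smooth_fun_constant[of ?h])
    show "smooth_fun A ?h" by (rule tensor02_smooth[OF \<alpha>(1) xi_vector_field xi_vector_field])
    fix X p assume X: "vector_field A X"
    \<comment> \<open>By \<open>tensor_D_xi\<close> the right-hand side contains the factor
      \<alpha>(\<xi>, X) - \<eta>(X) \<alpha>(\<xi>, \<xi>), which is 0 by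
      \<open>xi\<close>.\<close>
    have "X p ?h = 2 * \<alpha> p (\<xi> p) (D X \<xi> p)"
      unfolding parallel_deriv[OF \<alpha>(3) X xi_vector_field xi_vector_field]
      using sym[OF vector_field_tangent[OF D_vector_field[OF X xi_vector_field]] xi_tangent] by simp
    then show "X p ?h = 0"
      using tensor_D_xi[OF \<alpha>(1) X xi_tangent] xi[OF vector_field_tangent[OF X]]
        sym[OF vector_field_tangent[OF X] xi_tangent] by simp
  qed
  then obtain c where c: "\<And>p. ?h p = c" by blast
  have "\<alpha> p u v = c * g p u v" if u: "u \<in> tangent_space A p" and v: "v \<in> tangent_space A p" for p u v
  proof -
    obtain X where X: "vector_field A X" "X p = u" using tangent_extend[OF u] .
    obtain Y where Y: "vector_field A Y" "Y p = v" using tangent_extend[OF v] .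
    have eq: "\<alpha> q (X q) (\<xi> q) = c * g q (X q) (\<xi> q)" for q
      using xi[OF vector_field_tangent[OF X(1)]] c by simp
    \<comment> \<open>The identity \<open>eq\<close> is differentiated along Y. The terms with
      \<nabla>_Y X agree by \<open>xi\<close>, hence so do those with \<nabla>_Y \<xi>.\<close>
    have "\<alpha> p (D Y X p) (\<xi> p) + \<alpha> p u (D Y \<xi> p) = Y p (\<lambda>q. \<alpha> q (X q) (\<xi> q))"
      using parallel_deriv[OF \<alpha>(3) Y(1) X(1) xi_vector_field] X(2) by simp
    also have "\<dots> = c * (g p (D Y X p) (\<xi> p) + g p u (D Y \<xi> p))"
      unfolding eq tangent_cmult[OF vector_field_tangent[OF Y(1)] tensor02_smooth[OF g_tensor X(1) xi_vector_field]]
        parallel_deriv[OF g_parallel Y(1) X(1) xi_vector_field] X(2) ..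
    finally have "\<alpha> p u (D Y \<xi> p) = c * g p u (D Y \<xi> p)"
      using xi[OF vector_field_tangent[OF D_vector_field[OF Y(1) X(1)]], of p] c by (simp add: algebra_simps)
    then have "f p * (\<alpha> p u v - g p v (\<xi> p) * \<alpha> p u (\<xi> p)) = f p * (c * (g p u v - g p v (\<xi> p) * g p u (\<xi> p)))"
      using tensor_D_xi[OF \<alpha>(1) Y(1) u] tensor_D_xi[OF g_tensor Y(1) u] Y(2) by simp
    \<comment> \<open>The terms containing \<eta>(Y) agree by \<open>eq\<close>, and f > 0 can be
      cancelled.\<close>
    then show ?thesis
      using f_pos[of p] eq[of p] X(2) by (simp add: algebra_simps)
  qed
  then show ?thesis by blast
qed

section \<open>Parallel decompositions of the tangent bundle\<close>

text \<open>For sections \<open>U\<close> of \<open>E1\<close> and \<open>V\<close> of \<open>E2\<close>, the \<open>E1\<close>-component of the first Bianchi identity for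
  \<open>U\<close>, \<open>V\<close>, \<open>\<xi>\<close> reads \<open>R(V, \<xi>)U = (f\<^sup>2 + \<xi>(f)) \<eta>(V) U\<close>, while \<open>R(V, \<xi>)\<close> is skew.\<close>

lemma parallel_complement_orthogonal_xi:
  assumes E1: "subbundle A E1" "parallel_subbundle A D E1" "nonzero_subbundle E1"
    and E2: "subbundle A E2" "parallel_subbundle A D E2"
    and disj: "E1 p \<inter> E2 p = {0}" and v: "v \<in> E2 p"
  shows "g p v (\<xi> p) = 0"
proof -
  obtain u where u: "u \<in> E1 p" "u \<noteq> 0" using subbundle_nonzero[OF E1(1,3)] .
  obtain U where U: "vector_field A U" "\<And>q. U q \<in> E1 q" "U p = u"
    using subbundle_section_extend[OF E1(1) u(1)] by blast
  obtain V where V: "vector_field A V" "\<And>q. V q \<in> E2 q" "V p = v"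
    using subbundle_section_extend[OF E2(1) v] by blast
  let ?k = "(f p)\<^sup>2 + \<xi> p f"
  have curv: "curvature D X Y Z p \<in> E p"
    if E: "subbundle A E" "parallel_subbundle A D E" and X: "vector_field A X"
      and Y: "vector_field A Y" and Z: "vector_field A Z" "\<And>q. Z q \<in> E q" for E X Y Z
  proof -
    have par: "D X Z q \<in> E q" if "vector_field A X" "vector_field A Z" "\<And>q. Z q \<in> E q" for X Z q
      using E(2) that unfolding parallel_subbundle_def by blast
    have "D X (D Y Z) p \<in> E p" "D Y (D X Z) p \<in> E p" "D (lie_bracket X Y) Z p \<in> E p"
      by (intro par D_vector_field lie_bracket_vector_field X Y Z)+
    then show ?thesis unfolding curvature_def by (simp add: subbundle_diff[OF E(1)])
  qed
  \<comment> \<open>R(U, V)\<xi> is a combination of u and v at p. Adding its u-part to R(V, \<xi>)U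
    gives a, adding its v-part to R(\<xi>, U)V gives b, and a + b = 0 by Bianchi. Hence a lies in
    both fibres and vanishes.\<close>
  define a where "a = curvature D V \<xi> U p - (?k * g p v (\<xi> p)) *\<^sub>T u"
  define b where "b = curvature D \<xi> U V p - (- ?k * g p u (\<xi> p)) *\<^sub>T v"
  have "a \<in> E1 p" unfolding a_def
    by (intro subbundle_diff[OF E1(1)] curv E1 V(1) xi_vector_field U subbundle_scale u)
  have b: "b \<in> E2 p" unfolding b_def
    by (intro subbundle_diff[OF E2(1)] curv E2 V xi_vector_field U(1) subbundle_scale v)
  have "curvature D U V \<xi> p h + curvature D V \<xi> U p h + curvature D \<xi> U V p h = 0" for h
    using fun_cong[OF fun_cong[OF first_Bianchi[OF U(1) V(1) xi_vector_field]], of p h] by simp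
  then have "a = (- 1) *\<^sub>T b"
    unfolding a_def b_def curvature_xi[OF U(1) V(1)] U(3) V(3) by (simp add: fun_eq_iff algebra_simps)
  then have "a \<in> E2 p" using subbundle_scale[OF E2(1) b] by simp
  with \<open>a \<in> E1 p\<close> disj have "a = 0" by blast
  then have "curvature D V \<xi> U p = (?k * g p v (\<xi> p)) *\<^sub>T u" unfolding a_def by simp
  moreover have "g p (curvature D V \<xi> U p) u = 0"
    using curvature_skew[OF g_tensor g_symmetric g_parallel V(1) xi_vector_field U(1), of p] U(3) by simp
  moreover have ut: "u \<in> tangent_space A p" using vector_field_tangent[OF U(1), of p] U(3) by simp
  ultimately have "?k * g p v (\<xi> p) * g p u u = 0"
    using tensor02_scale_left[OF g_tensor ut ut ut] by simp
  then show ?thesis using regularity[of p] g_pos[OF ut u(2)] by simp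
qed

theorem no_parallel_decomposition:
  assumes E1: "subbundle A E1" "parallel_subbundle A D E1" "nonzero_subbundle E1"
    and E2: "subbundle A E2" "parallel_subbundle A D E2" "nonzero_subbundle E2"
  shows "\<not> tangent_direct_sum A E1 E2"
proof
  assume "tangent_direct_sum A E1 E2"
  then have sum: "tangent_space A p = {u + w | u w. u \<in> E1 p \<and> w \<in> E2 p}"
    and disj: "E1 p \<inter> E2 p = {0}" for p
    unfolding tangent_direct_sum_def by blast+
  fix p
  obtain u w where uw: "\<xi> p = u + w" "u \<in> E1 p" "w \<in> E2 p"
    using xi_tangent[of p] unfolding sum by blast
  \<comment> \<open>Adding the zero vector of the other fibre shows that both components are
    tangent, as bilinearity of g requires.\<close>
  have "u + 0 \<in> tangent_space A p" "0 + w \<in> tangent_space A p"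
    unfolding sum using uw subbundle_zero[OF E1(1)] subbundle_zero[OF E2(1)] by blast+
  then have "g p (\<xi> p) (\<xi> p) = g p u (\<xi> p) + g p w (\<xi> p)"
    using tensor02_add_left[OF g_tensor _ _ xi_tangent, of u p w] uw(1) by simp
  moreover have "g p w (\<xi> p) = 0"
    by (rule parallel_complement_orthogonal_xi[OF E1 E2(1,2) disj uw(3)])
  moreover have "E2 p \<inter> E1 p = {0}" using disj by blast
  then have "g p u (\<xi> p) = 0"
    by (rule parallel_complement_orthogonal_xi[OF E2 E1(1,2) _ uw(2)])
  ultimately show False using g_xi_xi[of p] by simp
qed

end

theorem mainTheorem1:
  fixes A :: "('a::{t2_space,second_countable_topology}, 'b::euclidean_space) atlas"
    and \<phi> :: "'a \<Rightarrow> 'a tvec \<Rightarrow> 'a tvec"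
    and \<xi> :: "'a \<Rightarrow> 'a tvec"
    and \<eta> :: "'a \<Rightarrow> 'a tvec \<Rightarrow> real"
    and g :: "'a \<Rightarrow> 'a tvec \<Rightarrow> 'a tvec \<Rightarrow> real"
    and D :: "'a conn"
    and f :: "'a \<Rightarrow> real"
  assumes "regular_f_Kenmotsu_manifold A \<phi> \<xi> \<eta> g D f"
  shows "(\<forall>\<alpha>. tensor02 A \<alpha> \<and> symmetric_tensor A \<alpha> \<and> parallel_tensor02 A D \<alpha> \<longrightarrow>
            (\<exists>c::real. \<forall>p. \<forall>u\<in>tangent_space A p. \<forall>v\<in>tangent_space A p. \<alpha> p u v = c * g p u v))
         \<and> \<not> (\<exists>E1 E2. subbundle A E1 \<and> subbundle A E2 \<and>
              nonzero_subbundle E1 \<and> nonzero_subbundle E2 \<and> tangent_direct_sum A E1 E2 \<and>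
              parallel_subbundle A D E1 \<and> parallel_subbundle A D E2)"
proof -
  interpret regular_f_Kenmotsu A \<phi> \<xi> \<eta> g D f
    using assms by unfold_locales
  show ?thesis
    using parallel_symmetric_tensor no_parallel_decomposition by blast
qed

end
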